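(* Let $\rho:\mathbb{R}\to\mathbb{R}$, $\rho(x)=\max\{0,x\}$, $\alpha\in(0,\tfrac12)$, and $\beta\in(0,\alpha)$. For $k\in\mathbb{N}$ let $V(k,\alpha,\beta,\sqrt{k})\subseteq L^2([0,1])$ be the set $V(k,\alpha,\beta,\mu)$ defined in the context with the choice $\mu=\sqrt{k}$. These are examples of function classes for which there is an arbitrarily large gap between compositional (neural network) and Riesz approximation rates. More specifically, $$\lim_{k\to\infty}\gamma^{\mathcal{N}}_\rho(V(k,\alpha,\beta,\sqrt{k}))=\infty,\qquad\text{whereas}\qquad \lim_{k\to\infty}\gamma^{\mathrm{Riesz}}(V(k,\alpha,\beta,\sqrt{k}))\leq\frac12.$$
   Context: Notation: for $r\in\mathbb{R}_+$, $[r]=\{1,\dots,\lfloor r\rfloor\}$; $\mathcal{P}_+$ is the set of univariate polynomials with non-negative coefficients; $\|\cdot\|_0$ counts nonzero entries of a vector or matrix; for matrices $\|A\|_\infty=\max_{i,j}|A_{i,j}|$; $\mathcal{O}_{M\to\infty}(f(M))=\{g:\mathbb{N}\to\mathbb{R}:\ \lim_{M\to\infty}g(M)/f(M)<\infty\}$. The Hilbert space is $\mathcal{H}=L^2([0,1])$ (real-valued functions). Approximation rate: for $\mathcal{C}\subseteq\mathcal{H}$ and a sequence $\mathcal{S}=(S_M)_{M\in\mathbb{N}}$ of sets $S_M\subseteq\mathcal{H}$, $$\gamma(\mathcal{C},\mathcal{S}):=\sup\Big\{\gamma>0:\ \Big(M\mapsto\sup_{f\in\mathcal{C}}\inf_{h\in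 S_M}\|f-h\|_{\mathcal{H}}\Big)\in\mathcal{O}_{M\to\infty}(M^{-\gamma})\Big\},\qquad \sup\emptyset=-\infty.$$ Riesz approximation rate: for $T\subseteq\mathbb{N}$, $c\in(0,\infty)$, a family $\mathcal{D}=(\phi_i)_{i\in T}\subseteq\mathcal{H}$ is a $c$-Riesz dictionary if $\|\phi_i\|_{\mathcal{H}}=1$ for all $i\in T$ and $\|\sum_{i\in T}a_i\phi_i\|_{\mathcal{H}}^2\geq c\sum_{i\in T}|a_i|^2$ for every finitely supported $(a_i)_{i\in T}\subseteq\mathbb{R}$; $\mathrm{Riesz}_c(\mathcal{H})$ is the set of these. For a polynomial $\pi$, $\mathcal{S}(\mathcal{D},\pi)=(S_M)_{M\in\mathbb{N}}$ with $S_M:=\{\sum_{i\in I}c_i\phi_i: I\subseteq[\pi(M)]\cap T,\ |I|\leq M,\ c\in\mathbb{R}^I,\ \|c\|_\infty\leq\pi(M)\}$. Then $\gamma^{\mathrm{Riesz}}(\mathcal{C}):=\sup_{c\in(0,\infty),\,\mathcal{D}\in\mathrm{Riesz}_c(\mathcal{H}),\,\pi\in\mathcal{P}_+}\gamma(\mathcal{C},\mathcal{S}(\mathcal{D},\pi))$. Neural network rate: a neural network with input dimension $d$ and output dimension $d'$ is a tuple $\Theta=(A_\ell,b_\ell)_{\ell=1}^L$, $L\in\mathbb{N}$, with $A_\ell\in\mathbb{R}^{N_\ell\times N_{\ell-1}}$, $b_\ell\in\mathbb{R}^{N_\ell}$, $N_0,\dots,N_L\in\mathbb{N}$, $N_0=d$,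 $N_L=d'$; the set of these is $\mathcal{N}_{d,d'}$. Its realization is $\mathcal{R}_\rho(\Theta)=W_L\circ\rho\circ W_{L-1}\circ\dots\circ\rho\circ W_1$ with $W_\ell(x)=A_\ell x+b_\ell$ and $\rho$ applied componentwise. Depth $\mathcal{L}(\Theta)=L$; connectivity $\mathcal{M}(\Theta)=\sum_{\ell=1}^L(\|A_\ell\|_0+\|b_\ell\|_0)$; weight magnitude $\mathcal{B}(\Theta)=\max_{\ell\in[L]}\max\{\|A_\ell\|_\infty,\|b_\ell\|_\infty\}$. For $\pi\in\mathcal{P}_+$, $\mathcal{S}_{\mathcal{N}}(\rho,\pi)=(S_M)_{M\in\mathbb{N}}$ with $S_M=\{\mathcal{R}_\rho(\Theta):\Theta\in\mathcal{N}_{d,d'},\ \mathcal{M}(\Theta)\leq M,\ \mathcal{L}(\Theta)\leq\pi(\log M),\ \mathcal{B}(\Theta)\leq\pi(M)\}$ (here $d=d'=1$, realizations restricted to $[0,1]$), and $\gamma^{\mathcal{N}}_\rho(\mathcal{C}):=\sup_{\pi\in\mathcal{P}_+}\gamma(\mathcal{C},\mathcal{S}_{\mathcal{N}}(\rho,\pi))$. The set $V(k,\alpha,\beta,\mu)$ for $k\in\mathbb{N}$, $\mu\in(0,\infty)$: let $f:\mathbb{R}\to[0,1]$ be the hat function $f(x)=2x$ for $x\in[0,\frac12)$, $f(x)=2(1-x)$ for $x\in[\frac12,1]$, $f(x)=0$ otherwise. For $m\in\mathbb{N}$, $a\in\{0,1\}^m$ let $f_a\in L^2([0,1])$ be given by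 $f_a(x)=\sum_{j=1}^m a_jf(m(x-\frac{j-1}{m}))$. For $m,k\in\mathbb{N}$ let $A_{m,k}=\{\bm{a}=(a^1,\dots,a^k): a^1,\dots,a^k\in\{0,1\}^m\}$ and $H_{m,k}=\{F_{\bm{a}}=f_{a^k}\circ\dots\circ f_{a^1}:\bm{a}\in A_{m,k}\}$. There exists $m_0\in\mathbb{N}$ (depending on $k,\alpha,\beta$) such that for every $m\geq m_0$ there is a set $H_{m,k,\alpha,\beta}\subseteq H_{m,k}$ with $$\max_{h,h'\in H_{m,k,\alpha,\beta},\,h\neq h'}\left|\left\langle\frac{h}{\|h\|_{L^2([0,1])}},\frac{h'}{\|h'\|_{L^2([0,1])}}\right\rangle\right|\leq 2m^{k(\beta-\alpha)}\qquad\text{and}\qquad |H_{m,k,\alpha,\beta}|\geq\frac{1}{2k}m^{(\frac12-\alpha)m^\beta}.$$ For each $k$, fix such an $m_0$ and, for every $m\geq m_0$, such a set $H_{m,k,\alpha,\beta}$. Let $V_m(k,\alpha,\beta,\mu)=\{m^{-\mu}h/\|h\|_{L^2([0,1])}:h\in H_{m,k,\alpha,\beta}\}$ for $m\geq m_0$ and $V_m(k,\alpha,\beta,\mu)=\emptyset$ for $m<m_0$. Then $V(k,\alpha,\beta,\mu)=(V_m(k,\alpha,\beta,\mu))_{m\in\mathbb{N}}$, identified, when used as a function class, with the union $\bigcup_{m\in\mathbb{N}}V_m(k,\alpha,\beta,\mu)$. *)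

theory Defs
  imports
    "HOL-Analysis.Analysis"
    "HOL-Real_Asymp.Real_Asymp"
    "HOL-Computational_Algebra.Polynomial"
    "Jordan_Normal_Form.Matrix"
begin

(* Matrices and vectors are those of Jordan_Normal_Form, with run-time dimensions. *)
unbundle no vec_syntax
hide_type (open) Finite_Cartesian_Product.vec
hide_const (open) Finite_Cartesian_Product.vec

(* Elements of the Hilbert space are represented by square integrable functions
   real => real, of which only the restriction to [0,1] matters; no quotient by
   a.e. equality is taken, since every quantity below depends on the class only. *)

definition L2 :: "(real \<Rightarrow> real) set" where
  "L2 = {f. f \<in> borel_measurable (lebesgue_on {0..1}) \<and>
            integrable (lebesgue_on {0..1}) (\<lambda>x. (f x)\<^sup>2)}"

definition L2_inner :: "(real \<Rightarrow> real) \<Rightarrow> (real \<Rightarrow> real) \<Rightarrow> real" where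
  "L2_inner f g = (LINT x|lebesgue_on {0..1}. f x * g x)"

definition L2_norm :: "(real \<Rightarrow> real) \<Rightarrow> real" where
  "L2_norm f = sqrt (L2_inner f f)"

definition L2_normalize :: "(real \<Rightarrow> real) \<Rightarrow> real \<Rightarrow> real" where
  "L2_normalize h = (\<lambda>x. h x / L2_norm h)"

definition nonneg_polys :: "real poly set" where
  "nonneg_polys = {\<pi>. \<forall>i. 0 \<le> coeff \<pi> i}"


section \<open>Approximation rates\<close>

(* Values in ennreal: the infimum over an empty approximation set is infinite. *)
definition approx_error :: "(real \<Rightarrow> real) set \<Rightarrow> (real \<Rightarrow> real) set \<Rightarrow> ennreal" where
  "approx_error C S = (SUP f\<in>C. INF h\<in>S. ennreal (L2_norm (\<lambda>x. f x - h x)))"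

definition big_O :: "(nat \<Rightarrow> real) \<Rightarrow> (nat \<Rightarrow> ennreal) set" where
  "big_O f = {g. limsup (\<lambda>M. g M / ennreal (f M)) < \<infinity>}"

(* In ereal the supremum of the empty set is -\<infinity>, as required. *)
definition approx_rate ::
    "(real \<Rightarrow> real) set \<Rightarrow> (nat \<Rightarrow> (real \<Rightarrow> real) set) \<Rightarrow> ereal" where
  "approx_rate C S =
     (SUP \<gamma>\<in>{\<gamma>::real. \<gamma> > 0 \<and> (\<lambda>M. approx_error C (S M)) \<in> big_O (\<lambda>M. real M powr (-\<gamma>))}.
        ereal \<gamma>)"

(* Reading the O-condition with a genuine limit instead of a limsup gives the
   same rate: a finite limsup at \<gamma> forces the limit 0 at every smaller exponent. *)
lemma approx_rate_eq_lim:
  "approx_rate C S =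
     (SUP \<gamma>\<in>{\<gamma>::real. \<gamma> > 0 \<and>
        (\<exists>l<\<infinity>. (\<lambda>M. approx_error C (S M) / ennreal (real M powr (-\<gamma>))) \<longlonglongrightarrow> l)}. ereal \<gamma>)"
    (is "_ = (SUP \<gamma>\<in>?L. ereal \<gamma>)")
proof (rule antisym)
  let ?e = "\<lambda>M. approx_error C (S M)"
  have lower: "\<delta> \<in> ?L" if g: "?e \<in> big_O (\<lambda>M. real M powr (-\<gamma>))" and d: "0 < \<delta>" "\<delta> < \<gamma>" for \<gamma> \<delta> :: real
  proof -
    have "limsup (\<lambda>M. ?e M / ennreal (real M powr (-\<gamma>))) < \<infinity>"
      using g by (simp add: big_O_def)
    then obtain B where B: "limsup (\<lambda>M. ?e M / ennreal (real M powr (-\<gamma>))) < B" "B < \<infinity>"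
      using dense by blast
    then obtain b where b: "B = ennreal b" "b \<ge> 0"
      by (cases B) auto
    have ev: "\<forall>\<^sub>F M in sequentially. ?e M / ennreal (real M powr (-\<gamma>)) < B"
      using B(1) by (rule Limsup_lessD)
    have le: "\<forall>\<^sub>F M in sequentially. ?e M / ennreal (real M powr (-\<delta>)) \<le> ennreal (b * real M powr (\<delta> - \<gamma>))"
      using ev eventually_gt_at_top[of 0]
    proof eventually_elim
      case (elim M)
      let ?x = "real M powr (-\<gamma>)" and ?y = "real M powr (-\<delta>)"
      have pos: "?x > 0" "?y > 0" using elim by auto
      have "?e M = ?e M / ennreal ?x * ennreal ?x"
        using pos by (simp add: ennreal_divide_times ennreal_times_divide[symmetric] ennreal_divide_self)
      also have "\<dots> \<le> ennreal b * ennreal ?x"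
        using elim b by (intro mult_right_mono) auto
      also have "\<dots> = ennreal (b * ?x)"
        using b by (simp add: ennreal_mult)
      finally have "?e M / ennreal ?y \<le> ennreal (b * ?x) / ennreal ?y"
        by (rule divide_right_mono_ennreal)
      also have "\<dots> = ennreal (b * ?x / ?y)"
        using pos b by (simp add: divide_ennreal)
      also have "b * ?x / ?y = b * real M powr (\<delta> - \<gamma>)"
        using elim by (simp add: powr_diff powr_minus field_simps)
      finally show ?case .
    qed
    have "(\<lambda>M. real M powr (\<delta> - \<gamma>)) \<longlonglongrightarrow> 0"
      using d by (intro tendsto_neg_powr filterlim_real_sequentially) auto
    then have "(\<lambda>M. ennreal (b * real M powr (\<delta> - \<gamma>))) \<longlonglongrightarrow> ennreal (b * 0)"
      by (intro tendsto_ennrealI tendsto_mult_left)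
    then have "(\<lambda>M. ?e M / ennreal (real M powr (-\<delta>))) \<longlonglongrightarrow> 0"
      using le by (intro tendsto_sandwich[OF _ le tendsto_const]) auto
    then show ?thesis
      using d(1) by (auto intro!: exI[of _ 0])
  qed
  show "approx_rate C S \<le> (SUP \<gamma>\<in>?L. ereal \<gamma>)"
    unfolding approx_rate_def
  proof (rule SUP_least)
    fix \<gamma> :: real
    assume g: "\<gamma> \<in> {\<gamma>. \<gamma> > 0 \<and> ?e \<in> big_O (\<lambda>M. real M powr (-\<gamma>))}"
    have le: "ereal (\<gamma> * (1 - 1 / real (n + 2))) \<le> (SUP \<gamma>\<in>?L. ereal \<gamma>)" for n
      using g by (intro SUP_upper lower[of \<gamma>]) (auto simp: field_simps intro!: add_pos_nonneg)
    have "(\<lambda>n. \<gamma> * (1 - 1 / real (n + 2))) \<longlonglongrightarrow> \<gamma>"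
      by real_asymp
    then have "(\<lambda>n. ereal (\<gamma> * (1 - 1 / real (n + 2)))) \<longlonglongrightarrow> ereal \<gamma>"
      by simp
    then show "ereal \<gamma> \<le> (SUP \<gamma>\<in>?L. ereal \<gamma>)"
      by (rule LIMSEQ_le_const2) (use le in blast)
  qed
  show "(SUP \<gamma>\<in>?L. ereal \<gamma>) \<le> approx_rate C S"
    unfolding approx_rate_def
    by (intro SUP_subset_mono) (auto simp: big_O_def dest: lim_imp_Limsup[rotated])
qed


section \<open>Riesz approximation rate\<close>

definition riesz_dictionary :: "real \<Rightarrow> nat set \<Rightarrow> (nat \<Rightarrow> real \<Rightarrow> real) \<Rightarrow> bool" where
  "riesz_dictionary c T \<phi> \<longleftrightarrow>
     (\<forall>i\<in>T. \<phi> i \<in> L2 \<and> L2_norm (\<phi> i) = 1) \<and>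
     (\<forall>a::nat \<Rightarrow> real. finite {i\<in>T. a i \<noteq> 0} \<longrightarrow>
        (L2_norm (\<lambda>x. \<Sum>i\<in>{i\<in>T. a i \<noteq> 0}. a i * \<phi> i x))\<^sup>2 \<ge>
        c * (\<Sum>i\<in>{i\<in>T. a i \<noteq> 0}. \<bar>a i\<bar>\<^sup>2))"

definition riesz_approximants ::
    "nat set \<Rightarrow> (nat \<Rightarrow> real \<Rightarrow> real) \<Rightarrow> real poly \<Rightarrow> nat \<Rightarrow> (real \<Rightarrow> real) set" where
  "riesz_approximants T \<phi> \<pi> M =
     {(\<lambda>x. \<Sum>i\<in>I. c i * \<phi> i x) | I c.
        I \<subseteq> {1..nat \<lfloor>poly \<pi> (real M)\<rfloor>} \<inter> T \<and> card I \<le> M \<and>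
        (\<forall>i\<in>I. \<bar>c i\<bar> \<le> poly \<pi> (real M))}"

definition riesz_rate :: "(real \<Rightarrow> real) set \<Rightarrow> ereal" where
  "riesz_rate C =
     Sup {approx_rate C (riesz_approximants T \<phi> \<pi>) | c T \<phi> \<pi>.
            c > 0 \<and> riesz_dictionary c T \<phi> \<and> \<pi> \<in> nonneg_polys}"


section \<open>Neural network approximation rate\<close>

type_synonym network = "(real mat \<times> real vec) list"

(* \<open>\<Theta> ! l\<close> is the layer \<open>(A\<^sub>l\<^sub>+\<^sub>1, b\<^sub>l\<^sub>+\<^sub>1)\<close> of the usual numbering from 1;
   the widths \<open>N 0, \<dots>, N L\<close> and the depth \<open>L = length \<Theta>\<close> are positive. *)
definition networks :: "nat \<Rightarrow> nat \<Rightarrow> network set" where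
  "networks d d' =
     {\<Theta>. \<Theta> \<noteq> [] \<and>
         (\<exists>N::nat \<Rightarrow> nat. N 0 = d \<and> N (length \<Theta>) = d' \<and> (\<forall>l\<le>length \<Theta>. N l \<ge> 1) \<and>
            (\<forall>l<length \<Theta>. fst (\<Theta> ! l) \<in> carrier_mat (N (Suc l)) (N l) \<and>
                          snd (\<Theta> ! l) \<in> carrier_vec (N (Suc l))))}"

(* The first clause is never reached from an element of \<open>networks d d'\<close>. *)
fun realization :: "(real \<Rightarrow> real) \<Rightarrow> network \<Rightarrow> real vec \<Rightarrow> real vec" where
  "realization \<rho> [] x = x"
| "realization \<rho> [(A, b)] x = A *\<^sub>v x + b"
| "realization \<rho> ((A, b) # layer # layers) x =
     realization \<rho> (layer # layers) (map_vec \<rho> (A *\<^sub>v x + b))"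

definition nnz_mat :: "real mat \<Rightarrow> nat" where
  "nnz_mat A = card {(i, j). i < dim_row A \<and> j < dim_col A \<and> A $$ (i, j) \<noteq> 0}"

definition nnz_vec :: "real vec \<Rightarrow> nat" where
  "nnz_vec b = card {i. i < dim_vec b \<and> b $ i \<noteq> 0}"

definition max_norm_mat :: "real mat \<Rightarrow> real" where
  "max_norm_mat A = Max {\<bar>A $$ (i, j)\<bar> | i j. i < dim_row A \<and> j < dim_col A}"

definition max_norm_vec :: "real vec \<Rightarrow> real" where
  "max_norm_vec b = Max {\<bar>b $ i\<bar> | i. i < dim_vec b}"

definition depth :: "network \<Rightarrow> nat" where
  "depth \<Theta> = length \<Theta>"

definition connectivity :: "network \<Rightarrow> nat" where
  "connectivity \<Theta> = (\<Sum>l<length \<Theta>. nnz_mat (fst (\<Theta> ! l)) + nnz_vec (snd (\<Theta> ! l)))"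

definition weight_magnitude :: "network \<Rightarrow> real" where
  "weight_magnitude \<Theta> =
     (MAX l\<in>{..<length \<Theta>}. max (max_norm_mat (fst (\<Theta> ! l))) (max_norm_vec (snd (\<Theta> ! l))))"

definition scalar_realization :: "(real \<Rightarrow> real) \<Rightarrow> network \<Rightarrow> real \<Rightarrow> real" where
  "scalar_realization \<rho> \<Theta> x = realization \<rho> \<Theta> (vec 1 (\<lambda>_. x)) $ 0"

definition nn_approximants :: "(real \<Rightarrow> real) \<Rightarrow> real poly \<Rightarrow> nat \<Rightarrow> (real \<Rightarrow> real) set" where
  "nn_approximants \<rho> \<pi> M =
     {scalar_realization \<rho> \<Theta> | \<Theta>.
        \<Theta> \<in> networks 1 1 \<and> connectivity \<Theta> \<le> M \<and>
        real (depth \<Theta>) \<le> poly \<pi> (ln (real M)) \<and>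
        weight_magnitude \<Theta> \<le> poly \<pi> (real M)}"

definition nn_rate :: "(real \<Rightarrow> real) \<Rightarrow> (real \<Rightarrow> real) set \<Rightarrow> ereal" where
  "nn_rate \<rho> C = (SUP \<pi>\<in>nonneg_polys. approx_rate C (nn_approximants \<rho> \<pi>))"


section \<open>The function classes\<close>

definition hat :: "real \<Rightarrow> real" where
  "hat x = (if 0 \<le> x \<and> x < 1/2 then 2 * x
            else if 1/2 \<le> x \<and> x \<le> 1 then 2 * (1 - x)
            else 0)"

definition hat_sum :: "nat \<Rightarrow> (nat \<Rightarrow> real) \<Rightarrow> real \<Rightarrow> real" where
  "hat_sum m a x = (\<Sum>j=1..m. a j * hat (real m * (x - (real j - 1) / real m)))"

primrec hat_comp :: "nat \<Rightarrow> (nat \<Rightarrow> nat \<Rightarrow> real) \<Rightarrow> nat \<Rightarrow> real \<Rightarrow> real" where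
  "hat_comp m a 0 = id"
| "hat_comp m a (Suc k) = hat_sum m (a (Suc k)) \<circ> hat_comp m a k"

definition index_set :: "nat \<Rightarrow> nat \<Rightarrow> (nat \<Rightarrow> nat \<Rightarrow> real) set" where
  "index_set m k = {1..k} \<rightarrow>\<^sub>E ({1..m} \<rightarrow>\<^sub>E {0, 1})"

definition hat_comps :: "nat \<Rightarrow> nat \<Rightarrow> (real \<Rightarrow> real) set" where
  "hat_comps m k = {hat_comp m a k | a. a \<in> index_set m k}"

(* The functions in \<open>hat_comps m k\<close> (k \<ge> 1) are continuous and vanish off [0,1],
   so equality of functions is equality in L2. The condition on the norm makes
   the normalization meaningful. *)
definition admissible_subset ::
    "nat \<Rightarrow> nat \<Rightarrow> real \<Rightarrow> real \<Rightarrow> (real \<Rightarrow> real) set \<Rightarrow> bool" where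
  "admissible_subset m k \<alpha> \<beta> H \<longleftrightarrow>
     H \<subseteq> hat_comps m k \<and>
     (\<forall>h\<in>H. L2_norm h \<noteq> 0) \<and>
     (\<forall>h\<in>H. \<forall>h'\<in>H. h \<noteq> h' \<longrightarrow>
        \<bar>L2_inner (L2_normalize h) (L2_normalize h')\<bar> \<le> 2 * real m powr (real k * (\<beta> - \<alpha>))) \<and>
     real (card H) \<ge> 1 / (2 * real k) * real m powr ((1/2 - \<alpha>) * real m powr \<beta>)"

(* \<open>m\<^sub>0\<close> and \<open>H m\<close> (for m \<ge> m\<^sub>0) are the choices fixed for the given k, \<alpha>, \<beta>. *)
definition admissible_choice ::
    "nat \<Rightarrow> real \<Rightarrow> real \<Rightarrow> nat \<Rightarrow> (nat \<Rightarrow> (real \<Rightarrow> real) set) \<Rightarrow> bool" where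
  "admissible_choice k \<alpha> \<beta> m\<^sub>0 H \<longleftrightarrow> m\<^sub>0 \<ge> 1 \<and> (\<forall>m\<ge>m\<^sub>0. admissible_subset m k \<alpha> \<beta> (H m))"

definition V_level ::
    "nat \<Rightarrow> (nat \<Rightarrow> (real \<Rightarrow> real) set) \<Rightarrow> real \<Rightarrow> nat \<Rightarrow> (real \<Rightarrow> real) set" where
  "V_level m\<^sub>0 H \<mu> m =
     (if m \<ge> m\<^sub>0 then {(\<lambda>x. real m powr (-\<mu>) * L2_normalize h x) | h. h \<in> H m} else {})"

definition V_class ::
    "nat \<Rightarrow> (nat \<Rightarrow> (real \<Rightarrow> real) set) \<Rightarrow> real \<Rightarrow> (real \<Rightarrow> real) set" where
  "V_class m\<^sub>0 H \<mu> = (\<Union>m. V_level m\<^sub>0 H \<mu> m)"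

end

theory Submission
  imports Defs "HOL-Library.Nat_Bijection"
begin

text \<open>
  Write \<open>V\<^sub>k\<close> for the class with exponent \<open>\<mu> = sqrt k\<close>. Its level \<open>m\<close> consists of multiples, of norm
  \<open>m\<^sup>-\<^sup>\<mu>\<close>, of compositions of \<open>k\<close> sums of \<open>m\<close> hats.

  Neural networks. A hat sum is a ReLU network with one hidden layer and \<open>O(m)\<close> weights, so a
  composition of \<open>k\<close> of them is a network of depth \<open>O(k)\<close> with \<open>O(k m)\<close> weights. The normalizing factor
  is polynomial in \<open>m\<close>, since a nonzero composition reaches the value 1 and has a polynomially bounded
  Lipschitz constant (\<open>L2_norm_hat_comp_ge\<close>). Hence \<open>M\<close> weights represent the levels up to order \<open>M\<close>
  exactly and the zero network takes care of the others with an error of order \<open>M\<^sup>-\<^sup>\<mu>\<close>. The rate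
  is at least \<open>sqrt k\<close> (\<open>nn_rate_V_class_ge\<close>).

  Riesz dictionaries, upper bound. A unit vector that is close to a combination of \<open>M\<close> atoms has an
  inner product of order \<open>1 / sqrt M\<close> with one of them (\<open>correlated_atom\<close>). In an almost orthonormal
  family whose coherence is small compared with \<open>1 / M\<close>, only \<open>O(M)\<close> vectors can have such an inner
  product with the same atom (\<open>card_correlated_le\<close>). As the atoms are searched for among polynomially
  many, only polynomially many members of level \<open>m\<close> can be approximated to within half their norm as
  long as \<open>M\<close> is at most a small multiple of \<open>m\<^sup>\<delta>\<close>, where \<open>\<delta> = k (\<alpha> - \<beta>)\<close>. But their number is
  superpolynomial, so for this \<open>M\<close> the error is still of order \<open>m\<^sup>-\<^sup>\<mu>\<close>, and the rate is at most
  \<open>\<mu> / \<delta> = sqrt k / (k (\<alpha> - \<beta>))\<close> (\<open>riesz_rate_V_class_le\<close>).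

  Riesz dictionaries, lower bound. That the limit exists also requires the rate not to be \<open>-\<infinity>\<close>. The
  Walsh functions form an orthonormal dictionary whose first \<open>2 ^ n\<close> members span the step functions
  on the dyadic grid of width \<open>2\<^sup>-\<^sup>n\<close>; the polynomial Lipschitz bounds then give a positive rate
  (\<open>riesz_rate_V_class_ge_0\<close>). Consequently the Riesz rates converge to 0.
\<close>

section \<open>Square integrable functions on the unit interval\<close>

text \<open>Lebesgue measure on the unit interval, with respect to which the inner product is taken.\<close>

abbreviation unit_measure :: "real measure" where
  "unit_measure \<equiv> lebesgue_on {0..1}"

lemma L2_D:
  assumes "f \<in> L2"
  shows "f \<in> borel_measurable unit_measure" "integrable unit_measure (\<lambda>x. (f x)\<^sup>2)"
  using assms by (auto simp: L2_def)

lemma integrable_L2_mult: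
  assumes "f \<in> L2" "g \<in> L2"
  shows "integrable unit_measure (\<lambda>x. f x * g x)"
proof (rule Bochner_Integration.integrable_bound)
  show "integrable unit_measure (\<lambda>x. (f x)\<^sup>2 + (g x)\<^sup>2)"
    using assms by (intro Bochner_Integration.integrable_add L2_D)
  show "(\<lambda>x. f x * g x) \<in> borel_measurable unit_measure"
    using assms by (intro borel_measurable_times L2_D)
  have "\<bar>u * v\<bar> \<le> u\<^sup>2 + v\<^sup>2" for u v :: real
  proof -
    define p where "p = \<bar>u * v\<bar>"
    have "0 \<le> (\<bar>u\<bar> - \<bar>v\<bar>)\<^sup>2" "0 \<le> p" by (simp_all add: p_def)
    then have "2 * p \<le> u\<^sup>2 + v\<^sup>2" "0 \<le> p"
      by (simp_all add: power2_diff p_def abs_mult)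
    then show ?thesis
      unfolding p_def[symmetric] by linarith
  qed
  then show "AE x in unit_measure. norm (f x * g x) \<le> norm ((f x)\<^sup>2 + (g x)\<^sup>2)"
    by simp
qed

lemma L2_cmult [intro]:
  assumes "f \<in> L2"
  shows "(\<lambda>x. c * f x) \<in> L2"
  using L2_D[OF assms] by (auto simp: L2_def power_mult_distrib)

lemma L2_add [intro]:
  assumes "f \<in> L2" "g \<in> L2"
  shows "(\<lambda>x. f x + g x) \<in> L2"
proof -
  have "integrable unit_measure (\<lambda>x. (f x)\<^sup>2 + (g x)\<^sup>2 + 2 * (f x * g x))"
    using assms by (intro Bochner_Integration.integrable_add L2_D integrable_mult_right integrable_L2_mult)
  then show ?thesis
    using assms by (auto simp: L2_def power2_sum mult.assoc)
qed

lemma L2_zero [simp, intro]: "(\<lambda>x. 0) \<in> L2"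
  by (simp add: L2_def)

lemma L2_diff [intro]:
  assumes "f \<in> L2" "g \<in> L2"
  shows "(\<lambda>x. f x - g x) \<in> L2"
  using L2_add[OF assms(1) L2_cmult[OF assms(2), of "-1"]] by simp

lemma L2_sum [intro]:
  assumes "\<And>i. i \<in> I \<Longrightarrow> f i \<in> L2"
  shows "(\<lambda>x. \<Sum>i\<in>I. f i x) \<in> L2"
  using assms by (induction I rule: infinite_finite_induct) auto

lemma L2_bounded:
  assumes "f \<in> borel_measurable unit_measure" "\<And>x. \<bar>f x\<bar> \<le> B"
  shows "f \<in> L2"
proof -
  have "integrable unit_measure (\<lambda>x. (f x)\<^sup>2)"
  proof (rule Bochner_Integration.integrable_bound)
    show "integrable unit_measure (\<lambda>x. B\<^sup>2)"
      by (rule finite_measure.integrable_const) (simp add: finite_measure_lebesgue_on)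
    show "(\<lambda>x. (f x)\<^sup>2) \<in> borel_measurable unit_measure"
      using assms by simp
    have "(f x)\<^sup>2 \<le> B\<^sup>2" for x
      using power_mono[OF assms(2)[of x] abs_ge_zero, of 2] by simp
    then show "AE x in unit_measure. norm ((f x)\<^sup>2) \<le> norm (B\<^sup>2)" by simp
  qed
  with assms show ?thesis by (simp add: L2_def)
qed

lemma L2_inner_commute: "L2_inner f g = L2_inner g f"
  by (simp add: L2_inner_def mult.commute)

lemma L2_inner_cmult_left: "L2_inner (\<lambda>x. c * f x) g = c * L2_inner f g"
  by (simp add: L2_inner_def mult.assoc)

lemma L2_inner_cmult_right: "L2_inner f (\<lambda>x. c * g x) = c * L2_inner f g"
  using L2_inner_cmult_left[of c g f] by (simp add: L2_inner_commute)

lemma L2_inner_sum_left: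
  assumes "\<And>i. i \<in> I \<Longrightarrow> f i \<in> L2" "h \<in> L2"
  shows "L2_inner (\<lambda>x. \<Sum>i\<in>I. f i x) h = (\<Sum>i\<in>I. L2_inner (f i) h)"
  using assms by (simp add: L2_inner_def sum_distrib_right integrable_L2_mult)

lemma L2_inner_sum_right:
  assumes "\<And>i. i \<in> I \<Longrightarrow> f i \<in> L2" "h \<in> L2"
  shows "L2_inner h (\<lambda>x. \<Sum>i\<in>I. f i x) = (\<Sum>i\<in>I. L2_inner h (f i))"
  using L2_inner_sum_left[OF assms] by (simp add: L2_inner_commute)

lemma L2_inner_self_nonneg: "0 \<le> L2_inner f f"
  by (simp add: L2_inner_def)

lemma L2_norm_nonneg: "0 \<le> L2_norm f"
  by (simp add: L2_norm_def L2_inner_self_nonneg)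

lemma L2_norm_power2: "(L2_norm f)\<^sup>2 = L2_inner f f"
  by (simp add: L2_norm_def L2_inner_self_nonneg)

lemma L2_norm_cmult: "L2_norm (\<lambda>x. c * f x) = \<bar>c\<bar> * L2_norm f"
proof -
  have "L2_norm (\<lambda>x. c * f x) = sqrt (c\<^sup>2 * L2_inner f f)"
    by (simp add: L2_norm_def L2_inner_cmult_left L2_inner_cmult_right power2_eq_square)
  then show ?thesis
    by (simp add: L2_norm_def real_sqrt_mult)
qed

lemma L2_norm_diff_power2:
  assumes "f \<in> L2" "g \<in> L2"
  shows "(L2_norm (\<lambda>x. f x - g x))\<^sup>2 = (L2_norm f)\<^sup>2 - 2 * L2_inner f g + (L2_norm g)\<^sup>2"
proof -
  have "(LINT x|unit_measure. (f x - g x) * (f x - g x)) =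
        (LINT x|unit_measure. (f x * f x - 2 * (f x * g x)) + g x * g x)"
    by (rule Bochner_Integration.integral_cong) (auto simp: algebra_simps)
  also have "\<dots> = (LINT x|unit_measure. f x * f x) - 2 * (LINT x|unit_measure. f x * g x)
      + (LINT x|unit_measure. g x * g x)"
    using assms by (simp add: integrable_L2_mult)
  finally show ?thesis
    by (simp add: L2_norm_power2 L2_inner_def)
qed

lemma L2_Cauchy_Schwarz:
  assumes f: "f \<in> L2" and g: "g \<in> L2"
  shows "\<bar>L2_inner f g\<bar> \<le> L2_norm f * L2_norm g"
proof -
  have expand: "0 \<le> (L2_norm f)\<^sup>2 - 2 * t * L2_inner f g + t\<^sup>2 * (L2_norm g)\<^sup>2" for t
    using L2_norm_diff_power2[OF f L2_cmult[OF g, of t]]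
      zero_le_power2[of "L2_norm (\<lambda>x. f x - t * g x)"]
    by (simp add: L2_inner_cmult_right L2_norm_cmult power_mult_distrib)
  show ?thesis
  proof (cases "L2_norm g = 0")
    case True
    have "L2_inner f g = 0"
    proof (rule ccontr)
      assume "L2_inner f g \<noteq> 0"
      then show False
        using expand[of "((L2_norm f)\<^sup>2 + 1) / (2 * L2_inner f g)"] True by simp
    qed
    with True show ?thesis by simp
  next
    case False
    then have "0 < (L2_norm g)\<^sup>2" by simp
    moreover have "0 \<le> (L2_norm f)\<^sup>2 - (L2_inner f g)\<^sup>2 / (L2_norm g)\<^sup>2"
      using expand[of "L2_inner f g / (L2_norm g)\<^sup>2"] False
      by (simp add: power2_eq_square divide_simps split: if_splits)
    ultimately have "(L2_inner f g)\<^sup>2 \<le> (L2_norm f * L2_norm g)\<^sup>2"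
      by (simp add: field_simps power_mult_distrib)
    then show ?thesis
      by (rule abs_le_square_iff[THEN iffD2, of _ "L2_norm f * L2_norm g", simplified abs_mult
            abs_of_nonneg[OF L2_norm_nonneg]])
  qed
qed

lemma AE_unit_less_1: "AE x in unit_measure. x \<in> {0..<1}"
proof -
  have "AE x in lebesgue. x \<noteq> (1::real)"
    by (rule AE_I[of _ _ "{1}"]) auto
  then show ?thesis
    by (auto simp: AE_restrict_space_iff)
qed

text \<open>The right end point is left out because the dyadic step functions below are controlled only
  on the half-open interval.\<close>

lemma L2_norm_le:
  assumes "f \<in> L2" "\<And>x. x \<in> {0..<1} \<Longrightarrow> \<bar>f x\<bar> \<le> B" "0 \<le> B"
  shows "L2_norm f \<le> B"
proof -
  have "L2_inner f f \<le> (LINT x|unit_measure. B\<^sup>2)"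
    unfolding L2_inner_def
  proof (rule integral_mono_AE)
    show "integrable unit_measure (\<lambda>x. f x * f x)"
      using assms(1) by (rule integrable_L2_mult[OF _ assms(1)])
    show "integrable unit_measure (\<lambda>x. B\<^sup>2)"
      by (rule finite_measure.integrable_const) (simp add: finite_measure_lebesgue_on)
    show "AE x in unit_measure. f x * f x \<le> B\<^sup>2"
      using AE_unit_less_1
    proof eventually_elim
      case (elim x)
      then show ?case
        using power_mono[OF assms(2)[OF elim] abs_ge_zero, of 2] by (simp add: power2_eq_square)
    qed
  qed
  also have "\<dots> = B\<^sup>2"
    by (simp add: measure_restrict_space)
  finally show ?thesis
    using assms(3) by (simp add: L2_norm_def real_le_lsqrt)
qed

text \<open>Lower bound for the norm: only the mass on a subinterval is used.\<close>

lemma L2_norm_ge: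
  assumes "f \<in> L2" "0 \<le> u" "u \<le> v" "v \<le> 1" "\<And>x. x \<in> {u..v} \<Longrightarrow> B \<le> \<bar>f x\<bar>" "0 \<le> B"
  shows "B * sqrt (v - u) \<le> L2_norm f"
proof -
  have "B\<^sup>2 * (v - u) = (LINT x|unit_measure. B\<^sup>2 * indicat_real {u..v} x)"
    using assms by (simp add: measure_restrict_space min_def max_def Int_absorb2)
  also have "\<dots> \<le> L2_inner f f"
    unfolding L2_inner_def
  proof (rule integral_mono)
    show "integrable unit_measure (\<lambda>x. f x * f x)"
      using assms(1) by (rule integrable_L2_mult[OF _ assms(1)])
    have "integrable unit_measure (indicat_real {u..v})"
      using assms by (intro integrable_real_indicator)
        (auto simp: sets_restrict_space emeasure_restrict_space Int_absorb2 intro!: image_eqI[of _ _ "{u..v}"])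
    then show "integrable unit_measure (\<lambda>x. B\<^sup>2 * indicat_real {u..v} x)" by simp
    show "B\<^sup>2 * indicat_real {u..v} x \<le> f x * f x" for x
      using power_mono[OF assms(5)[of x] assms(6), of 2]
      by (auto simp: indicator_def power2_eq_square)
  qed
  finally have "sqrt (B\<^sup>2 * (v - u)) \<le> L2_norm f"
    by (simp add: L2_norm_def)
  then show ?thesis
    using assms(6) by (simp add: real_sqrt_mult)
qed

lemma L2_continuous:
  assumes "continuous_on {0..1} f"
  shows "f \<in> L2"
proof -
  have "integrable unit_measure (\<lambda>x. (f x)\<^sup>2)"
    using integrable_continuous_real assms
    by (intro absolutely_integrable_imp_integrable absolutely_integrable_continuous_real continuous_intros) auto
  moreover have "f \<in> borel_measurable unit_measure"
    using assms by (rule continuous_imp_measurable_on_sets_lebesgue) auto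
  ultimately show ?thesis by (simp add: L2_def)
qed

lemma L2_norm_triangle:
  assumes f: "f \<in> L2" and g: "g \<in> L2"
  shows "L2_norm g \<le> L2_norm f + L2_norm (\<lambda>x. f x - g x)"
proof -
  let ?d = "\<lambda>x. f x - g x"
  have d: "?d \<in> L2" using f g by blast
  have "(L2_norm g)\<^sup>2 = (L2_norm f)\<^sup>2 - 2 * L2_inner f ?d + (L2_norm ?d)\<^sup>2"
    using L2_norm_diff_power2[OF f d] by simp
  also have "\<dots> \<le> (L2_norm f + L2_norm ?d)\<^sup>2"
    using L2_Cauchy_Schwarz[OF f d] by (simp add: power2_sum)
  finally show ?thesis
    by (rule power2_le_imp_le) (simp add: L2_norm_nonneg)
qed


section \<open>Compositions of sums of hats\<close>

lemma hat_eq_relu: "hat x = 2 * max 0 x - 4 * max 0 (x - 1/2) + 2 * max 0 (x - 1)"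
  by (auto simp: hat_def max_def)

lemma hat_nonneg: "0 \<le> hat x"
  by (auto simp: hat_def)

lemma hat_le_1: "hat x \<le> 1"
  by (auto simp: hat_def)

lemma hat_lipschitz: "\<bar>hat x - hat y\<bar> \<le> 2 * \<bar>x - y\<bar>"
  by (auto simp: hat_def abs_if)

lemma binary_range:
  assumes "a \<in> {1..m} \<rightarrow> {0, 1 :: real}" "j \<in> {1..m}"
  shows "a j = 0 \<or> a j = 1" "0 \<le> a j"
proof -
  show "a j = 0 \<or> a j = 1" using assms by (fastforce simp: Pi_iff)
  then show "0 \<le> a j" by auto
qed

lemma hat_sum_nonneg:
  assumes "a \<in> {1..m} \<rightarrow> {0, 1}"
  shows "0 \<le> hat_sum m a x"
  unfolding hat_sum_def by (intro sum_nonneg mult_nonneg_nonneg hat_nonneg binary_range(2)[OF assms])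

lemma hat_sum_le:
  assumes "a \<in> {1..m} \<rightarrow> {0, 1}"
  shows "hat_sum m a x \<le> real m"
proof -
  have "a j * hat (real m * (x - (real j - 1) / real m)) \<le> 1" if "j \<in> {1..m}" for j
    using binary_range(1)[OF assms that] hat_le_1 by auto
  then have "hat_sum m a x \<le> (\<Sum>j=1..m. 1)"
    unfolding hat_sum_def by (intro sum_mono)
  then show ?thesis by simp
qed

lemma hat_sum_0 [simp]: "hat_sum m a 0 = 0"
  by (auto simp: hat_sum_def hat_def intro!: sum.neutral)

text \<open>The supports of the summands are disjoint, so \<open>2 * m\<close> is a Lipschitz constant as well.
  The cruder constant comes from adding up the summands and changes only exponents that do not matter.\<close>

lemma hat_sum_lipschitz:
  assumes "a \<in> {1..m} \<rightarrow> {0, 1}"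
  shows "\<bar>hat_sum m a x - hat_sum m a y\<bar> \<le> 2 * (real m)\<^sup>2 * \<bar>x - y\<bar>"
proof -
  let ?t = "\<lambda>x j. real m * (x - (real j - 1) / real m)"
  have "\<bar>hat_sum m a x - hat_sum m a y\<bar> = \<bar>\<Sum>j=1..m. a j * (hat (?t x j) - hat (?t y j))\<bar>"
    by (simp add: hat_sum_def sum_subtractf right_diff_distrib)
  also have "\<dots> \<le> (\<Sum>j=1..m. 2 * real m * \<bar>x - y\<bar>)"
  proof (intro order_trans[OF sum_abs] sum_mono)
    fix j assume j: "j \<in> {1..m}"
    have "\<bar>a j * (hat (?t x j) - hat (?t y j))\<bar> \<le> \<bar>hat (?t x j) - hat (?t y j)\<bar>"
      using binary_range(1)[OF assms j] by auto
    also have "\<dots> \<le> 2 * \<bar>?t x j - ?t y j\<bar>"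
      by (rule hat_lipschitz)
    also have "?t x j - ?t y j = real m * (x - y)"
      by (simp add: algebra_simps)
    finally show "\<bar>a j * (hat (?t x j) - hat (?t y j))\<bar> \<le> 2 * real m * \<bar>x - y\<bar>"
      by (simp add: abs_mult)
  qed
  also have "\<dots> = 2 * (real m)\<^sup>2 * \<bar>x - y\<bar>"
    by (simp add: power2_eq_square)
  finally show ?thesis .
qed

lemma hat_sum_peak:
  assumes "a \<in> {1..m} \<rightarrow> {0, 1}" "j \<in> {1..m}" "a j = 1"
  shows "1 \<le> hat_sum m a ((real j - 1/2) / real m)"
proof -
  let ?x = "(real j - 1/2) / real m"
  have "real m * (?x - (real j - 1) / real m) = 1/2"
    using assms(2) by (simp add: field_simps)
  then have "1 = a j * hat (real m * (?x - (real j - 1) / real m))"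
    by (simp only: assms(3)) (simp add: hat_def)
  also have "\<dots> \<le> hat_sum m a ?x"
    unfolding hat_sum_def using assms(2) binary_range(2)[OF assms(1)]
    by (intro member_le_sum[where f = "\<lambda>j. a j * hat (real m * (?x - (real j - 1) / real m))"]
        mult_nonneg_nonneg hat_nonneg) auto
  finally show ?thesis .
qed

lemma index_set_D:
  assumes "a \<in> index_set m k" "i \<in> {1..k}"
  shows "a i \<in> {1..m} \<rightarrow> {0, 1}"
  using assms by (auto simp: index_set_def PiE_iff Pi_iff)

lemma hat_comp_0 [simp]: "hat_comp m a k 0 = 0"
  by (induction k) auto

context
  fixes m k :: nat and a :: "nat \<Rightarrow> nat \<Rightarrow> real"
  assumes m: "1 \<le> m" and a: "\<And>i. i \<in> {1..k} \<Longrightarrow> a i \<in> {1..m} \<rightarrow> {0, 1}"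
begin

lemma hat_comp_bounds:
  assumes "x \<in> {0..1}"
  shows "0 \<le> hat_comp m a k x \<and> hat_comp m a k x \<le> real m"
proof (cases k)
  case 0
  then show ?thesis using assms m by simp
next
  case (Suc n)
  have "a (Suc n) \<in> {1..m} \<rightarrow> {0, 1}" by (rule a) (simp add: Suc)
  with Suc show ?thesis
    by (simp add: hat_sum_nonneg hat_sum_le)
qed

lemma hat_comp_lipschitz:
  assumes "j \<le> k"
  shows "\<bar>hat_comp m a j x - hat_comp m a j y\<bar> \<le> (2 * (real m)\<^sup>2) ^ j * \<bar>x - y\<bar>"
  using assms
proof (induction j)
  case (Suc j)
  have "\<bar>hat_comp m a (Suc j) x - hat_comp m a (Suc j) y\<bar>
      \<le> 2 * (real m)\<^sup>2 * \<bar>hat_comp m a j x - hat_comp m a j y\<bar>"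
    using hat_sum_lipschitz[OF a[of "Suc j"]] Suc.prems by simp
  also have "\<dots> \<le> 2 * (real m)\<^sup>2 * ((2 * (real m)\<^sup>2) ^ j * \<bar>x - y\<bar>)"
    using Suc by (intro mult_left_mono) auto
  finally show ?case by (simp add: mult.assoc)
qed simp

lemma hat_comp_continuous:
  assumes "j \<le> k"
  shows "continuous_on S (hat_comp m a j)"
proof -
  have "((2 * (real m)\<^sup>2) ^ j)-lipschitz_on S (hat_comp m a j)"
    using hat_comp_lipschitz[OF assms] by (intro lipschitz_onI) (auto simp: dist_real_def)
  then show ?thesis by (rule lipschitz_on_continuous_on)
qed

text \<open>By the intermediate value theorem the inner composition takes all values in the unit
  interval once it reaches 1, in particular the location of a peak of the next hat sum.\<close>

lemma hat_comp_reaches_1: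
  assumes "j \<le> k" "x \<in> {0..1}" "hat_comp m a j x \<noteq> 0"
  shows "\<exists>y\<in>{0..1}. 1 \<le> hat_comp m a j y"
  using assms
proof (induction j)
  case 0
  show ?case by (intro bexI[of _ 1]) auto
next
  case (Suc j)
  have aj: "a (Suc j) \<in> {1..m} \<rightarrow> {0, 1}"
    using Suc.prems by (intro a) auto
  have "hat_comp m a j x \<noteq> 0"
    using Suc.prems(3) by (metis comp_apply hat_comp.simps(2) hat_sum_0)
  then obtain y where y: "y \<in> {0..1}" "1 \<le> hat_comp m a j y"
    using Suc by auto
  obtain i where i: "i \<in> {1..m}" "a (Suc j) i = 1"
  proof (rule ccontr)
    assume "\<not> thesis"
    then have "\<And>i. i \<in> {1..m} \<Longrightarrow> a (Suc j) i = 0"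
      using aj that by (fastforce simp: Pi_iff)
    then have "hat_comp m a (Suc j) x = 0"
      by (simp add: hat_sum_def)
    with Suc.prems(3) show False by simp
  qed
  let ?t = "(real i - 1/2) / real m"
  have "0 \<le> ?t" "?t \<le> 1"
    using i by (auto simp: field_simps)
  then obtain z where "0 \<le> z" "z \<le> y" "hat_comp m a j z = ?t"
    using IVT'[of "hat_comp m a j" 0 ?t y] y Suc.prems(1) hat_comp_continuous[of j "{0..y}"] by auto
  with y hat_sum_peak[OF aj i] show ?case
    by (intro bexI[of _ z]) auto
qed

lemma hat_comp_L2: "hat_comp m a k \<in> L2"
  by (intro L2_continuous hat_comp_continuous order_refl)

text \<open>A nonzero composition is at least 1 somewhere, hence at least \<open>1/2\<close> on an interval whose
  length is governed by the Lipschitz constant.\<close>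

lemma L2_norm_hat_comp_ge:
  assumes "L2_norm (hat_comp m a k) \<noteq> 0"
  shows "1 / (4 * (2 * (real m)\<^sup>2) ^ k) \<le> L2_norm (hat_comp m a k)"
proof -
  define L where "L = (2 * (real m)\<^sup>2) ^ k"
  have "1 \<le> (real m)\<^sup>2" using m by simp
  then have "1 \<le> 2 * (real m)\<^sup>2" by linarith
  then have L: "1 \<le> L"
    unfolding L_def by (rule one_le_power)
  have "\<exists>x\<in>{0..1}. hat_comp m a k x \<noteq> 0"
  proof (rule ccontr)
    assume "\<not> ?thesis"
    then have "L2_norm (hat_comp m a k) \<le> 0"
      using hat_comp_L2 by (intro L2_norm_le) auto
    with assms L2_norm_nonneg[of "hat_comp m a k"] show False by simp
  qed
  then obtain y where y: "y \<in> {0..1}" "1 \<le> hat_comp m a k y"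
    using hat_comp_reaches_1[OF order_refl] by blast
  define r where "r = 1 / (2 * L)"
  have r: "0 < r" "r \<le> 1 / 2" "L * r = 1 / 2"
    using L by (auto simp: r_def field_simps)
  \<comment> \<open>the interval lies to the right or to the left of \<open>y\<close>, whichever side stays inside the unit interval\<close>
  define u where "u = (if y \<le> 1/2 then y else y - r)"
  have "1/2 \<le> \<bar>hat_comp m a k x\<bar>" if "x \<in> {u..u + r}" for x
  proof -
    have "\<bar>y - x\<bar> \<le> r"
      using that by (auto simp: u_def split: if_splits)
    then have "L * \<bar>y - x\<bar> \<le> 1/2"
      using L mult_left_mono[of "\<bar>y - x\<bar>" r L] r by auto
    then show ?thesis
      using hat_comp_lipschitz[of k y x] y by (simp add: L_def)
  qed
  then have "1/2 * sqrt (u + r - u) \<le> L2_norm (hat_comp m a k)"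
    using r y by (intro L2_norm_ge hat_comp_L2) (auto simp: u_def)
  moreover have "r \<le> sqrt r"
    using r by (intro real_le_rsqrt) (simp add: power2_eq_square mult_le_cancel_right1)
  ultimately have "1 / 2 * r \<le> L2_norm (hat_comp m a k)"
    by simp
  then have "1 / (4 * L) \<le> L2_norm (hat_comp m a k)"
    by (simp add: r_def)
  then show ?thesis
    by (simp only: L_def)
qed

end

text \<open>Normalization costs only a factor that is polynomial in \<open>m\<close>: the scaling factor, the sup norm
  and the Lipschitz constant of a class member are bounded by fixed powers of \<open>m\<close>.\<close>

lemma hat_comp_scaled_bounds:
  assumes m: "1 \<le> m" and a: "a \<in> index_set m k" and nz: "L2_norm (hat_comp m a k) \<noteq> 0"
    and \<mu>: "0 \<le> \<mu>"
  defines "L \<equiv> (2 * (real m)\<^sup>2) ^ k"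
    and "s \<equiv> real m powr (-\<mu>) / L2_norm (hat_comp m a k)"
  shows "0 < s" "s \<le> 4 * L"
    and "x \<in> {0..1} \<Longrightarrow> \<bar>s * hat_comp m a k x\<bar> \<le> 4 * L * real m"
    and "\<bar>s * hat_comp m a k x - s * hat_comp m a k y\<bar> \<le> 4 * L\<^sup>2 * \<bar>x - y\<bar>"
proof -
  note ai = index_set_D[OF a]
  have N: "0 < L2_norm (hat_comp m a k)"
    using nz L2_norm_nonneg[of "hat_comp m a k"] by simp
  have L: "0 < L" using m by (simp add: L_def)
  have mp: "0 < real m powr (-\<mu>)" "real m powr (-\<mu>) \<le> 1"
    using m \<mu> powr_mono[of "-\<mu>" 0 "real m"] by auto
  show s0: "0 < s" using N mp by (simp add: s_def)
  have "s \<le> 1 / L2_norm (hat_comp m a k)"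
    unfolding s_def using mp N by (intro divide_right_mono) auto
  also have "\<dots> \<le> 1 / (1 / (4 * L))"
    using L2_norm_hat_comp_ge[OF m ai nz] L N by (intro divide_left_mono) (auto simp: L_def)
  finally show s: "s \<le> 4 * L" by simp
  show "\<bar>s * hat_comp m a k x\<bar> \<le> 4 * L * real m" if "x \<in> {0..1}"
    using hat_comp_bounds[OF m ai that] s0 s by (auto simp: abs_mult intro!: mult_mono)
  have lip: "\<bar>hat_comp m a k x - hat_comp m a k y\<bar> \<le> L * \<bar>x - y\<bar>"
    unfolding L_def by (rule hat_comp_lipschitz[OF m _ order_refl]) (rule ai)
  have "\<bar>s * hat_comp m a k x - s * hat_comp m a k y\<bar> = s * \<bar>hat_comp m a k x - hat_comp m a k y\<bar>"
    using s0 by (simp add: abs_mult right_diff_distrib[symmetric])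
  also have "\<dots> \<le> 4 * L * (L * \<bar>x - y\<bar>)"
    using lip s0 s L
    by (intro mult_mono) auto
  finally show "\<bar>s * hat_comp m a k x - s * hat_comp m a k y\<bar> \<le> 4 * L\<^sup>2 * \<bar>x - y\<bar>"
    by (simp add: power2_eq_square mult.assoc)
qed


section \<open>Members of the function classes and lower bounds for rates\<close>

lemma V_class_cases:
  assumes H: "admissible_choice k \<alpha> \<beta> m\<^sub>0 H" and f: "f \<in> V_class m\<^sub>0 H \<mu>"
  obtains m a where "1 \<le> m" "a \<in> index_set m k" "L2_norm (hat_comp m a k) \<noteq> 0"
    "f = (\<lambda>x. real m powr (-\<mu>) / L2_norm (hat_comp m a k) * hat_comp m a k x)"
    "f \<in> L2" "L2_norm f = real m powr (-\<mu>)"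
proof -
  obtain m h where m: "m\<^sub>0 \<le> m" and h: "h \<in> H m"
    and fh: "f = (\<lambda>x. real m powr (-\<mu>) * L2_normalize h x)"
    using f by (auto simp: V_class_def V_level_def split: if_splits)
  have adm: "admissible_subset m k \<alpha> \<beta> (H m)" and m1: "1 \<le> m"
    using H m by (auto simp: admissible_choice_def)
  then obtain a where a: "a \<in> index_set m k" "h = hat_comp m a k"
    using h by (auto simp: admissible_subset_def hat_comps_def)
  have nz: "L2_norm h \<noteq> 0"
    using adm h by (auto simp: admissible_subset_def)
  have fa: "f = (\<lambda>x. real m powr (-\<mu>) / L2_norm h * h x)"
    by (simp add: fh L2_normalize_def)
  have "h \<in> L2"
    unfolding a(2) by (rule hat_comp_L2[OF m1]) (rule index_set_D[OF a(1)])
  then have "f \<in> L2"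
    unfolding fa by (rule L2_cmult)
  moreover have "L2_norm f = real m powr (-\<mu>)"
    using nz L2_norm_nonneg[of h] unfolding fa L2_norm_cmult by simp
  ultimately show thesis
    using that[OF m1 a(1)] nz fa unfolding a(2) by simp
qed

lemma approx_rate_ge:
  assumes "0 < \<gamma>" "0 \<le> B"
    and ev: "\<forall>\<^sub>F M in sequentially. \<forall>f\<in>C. \<exists>h\<in>S M. L2_norm (\<lambda>x. f x - h x) \<le> B * real M powr (-\<gamma>)"
  shows "ereal \<gamma> \<le> approx_rate C S"
proof -
  have "\<forall>\<^sub>F M in sequentially. approx_error C (S M) / ennreal (real M powr (-\<gamma>)) \<le> ennreal B"
    using ev eventually_gt_at_top[of 0]
  proof eventually_elim
    case (elim M)
    have pos: "0 < real M powr (-\<gamma>)" using elim by simp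
    have "approx_error C (S M) \<le> ennreal (B * real M powr (-\<gamma>))"
      unfolding approx_error_def
    proof (rule SUP_least)
      fix f assume "f \<in> C"
      then obtain h where h: "h \<in> S M" "L2_norm (\<lambda>x. f x - h x) \<le> B * real M powr (-\<gamma>)"
        using elim by auto
      then show "(INF h\<in>S M. ennreal (L2_norm (\<lambda>x. f x - h x))) \<le> ennreal (B * real M powr (-\<gamma>))"
        by (intro INF_lower2[OF h(1)] ennreal_leI)
    qed
    then have "approx_error C (S M) / ennreal (real M powr (-\<gamma>))
        \<le> ennreal (B * real M powr (-\<gamma>)) / ennreal (real M powr (-\<gamma>))"
      by (rule divide_right_mono_ennreal)
    also have "\<dots> = ennreal B"
      using pos assms(2) by (simp add: divide_ennreal)
    finally show ?case .
  qed
  then have "limsup (\<lambda>M. approx_error C (S M) / ennreal (real M powr (-\<gamma>))) \<le> ennreal B"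
    by (rule Limsup_bounded)
  then have "(\<lambda>M. approx_error C (S M)) \<in> big_O (\<lambda>M. real M powr (-\<gamma>))"
    by (auto simp: big_O_def intro: le_less_trans)
  with assms(1) show ?thesis
    unfolding approx_rate_def by (intro SUP_upper) auto
qed


section \<open>Neural networks\<close>

lemma realization_append:
  assumes "\<Theta> \<noteq> []" "\<Theta>' \<noteq> []"
  shows "realization \<rho> (\<Theta> @ \<Theta>') x = realization \<rho> \<Theta>' (map_vec \<rho> (realization \<rho> \<Theta> x))"
  using assms
proof (induction \<rho> \<Theta> x rule: realization.induct)
  case (2 \<rho> A b x)
  then show ?case by (cases \<Theta>') auto
qed auto

lemma networks_single:
  assumes "A \<in> carrier_mat r c" "b \<in> carrier_vec r" "1 \<le> r" "1 \<le> c"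
  shows "[(A, b)] \<in> networks c r"
  unfolding networks_def using assms by (auto intro!: exI[of _ "\<lambda>l. if l = 0 then c else r"])

lemma networks_append:
  assumes "\<Theta> \<in> networks d e" "\<Theta>' \<in> networks e d'"
  shows "\<Theta> @ \<Theta>' \<in> networks d d'"
proof -
  obtain N where N: "N 0 = d" "N (length \<Theta>) = e" "\<forall>l\<le>length \<Theta>. N l \<ge> 1"
      "\<forall>l<length \<Theta>. fst (\<Theta> ! l) \<in> carrier_mat (N (Suc l)) (N l) \<and> snd (\<Theta> ! l) \<in> carrier_vec (N (Suc l))"
    and ne: "\<Theta> \<noteq> []" using assms(1) by (auto simp: networks_def)
  obtain N' where N': "N' 0 = e" "N' (length \<Theta>') = d'" "\<forall>l\<le>length \<Theta>'. N' l \<ge> 1"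
      "\<forall>l<length \<Theta>'. fst (\<Theta>' ! l) \<in> carrier_mat (N' (Suc l)) (N' l) \<and> snd (\<Theta>' ! l) \<in> carrier_vec (N' (Suc l))"
    and ne': "\<Theta>' \<noteq> []" using assms(2) by (auto simp: networks_def)
  define K where "K l = (if l \<le> length \<Theta> then N l else N' (l - length \<Theta>))" for l
  have K': "K (length \<Theta> + l) = N' l" for l
    using N(2) N'(1) by (cases l) (auto simp: K_def)
  have "fst ((\<Theta> @ \<Theta>') ! l) \<in> carrier_mat (K (Suc l)) (K l) \<and> snd ((\<Theta> @ \<Theta>') ! l) \<in> carrier_vec (K (Suc l))"
    if l: "l < length (\<Theta> @ \<Theta>')" for l
  proof (cases "l < length \<Theta>")
    case True
    then show ?thesis using N(4) by (auto simp: nth_append K_def)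
  next
    case False
    then obtain i where i: "l = length \<Theta> + i" by (metis le_Suc_ex not_less)
    then show ?thesis
      using N'(4) l K'[of i] K'[of "Suc i"] by (auto simp: nth_append)
  qed
  moreover have "1 \<le> K l" if "l \<le> length (\<Theta> @ \<Theta>')" for l
    using N(3) N'(3) that by (auto simp: K_def)
  moreover have "K 0 = d" "K (length (\<Theta> @ \<Theta>')) = d'"
    using N(1) K'[of "length \<Theta>'"] N'(2) by (auto simp: K_def)
  ultimately show ?thesis
    using ne unfolding networks_def by blast
qed

lemma connectivity_append: "connectivity (\<Theta> @ \<Theta>') = connectivity \<Theta> + connectivity \<Theta>'"
proof -
  have "connectivity \<Theta> = (\<Sum>(A, b)\<leftarrow>\<Theta>. nnz_mat A + nnz_vec b)" for \<Theta>
    by (simp add: connectivity_def sum_list_sum_nth atLeast0LessThan case_prod_beta)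
  then show ?thesis by simp
qed

lemma connectivity_Cons: "connectivity ((A, b) # \<Theta>) = nnz_mat A + nnz_vec b + connectivity \<Theta>"
  using connectivity_append[of "[(A, b)]" \<Theta>] by (simp add: connectivity_def)

lemma connectivity_Nil [simp]: "connectivity [] = 0"
  by (simp add: connectivity_def)

lemma nnz_mat_le: "nnz_mat A \<le> dim_row A * dim_col A"
proof -
  have "nnz_mat A \<le> card ({..<dim_row A} \<times> {..<dim_col A})"
    unfolding nnz_mat_def by (intro card_mono) auto
  then show ?thesis by simp
qed

lemma nnz_vec_le: "nnz_vec b \<le> dim_vec b"
proof -
  have "nnz_vec b \<le> card {..<dim_vec b}"
    unfolding nnz_vec_def by (intro card_mono) auto
  then show ?thesis by simp
qed

lemma max_norm_mat_le:
  assumes "1 \<le> dim_row A" "1 \<le> dim_col A"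
    and "\<And>i j. i < dim_row A \<Longrightarrow> j < dim_col A \<Longrightarrow> \<bar>A $$ (i, j)\<bar> \<le> B"
  shows "max_norm_mat A \<le> B"
proof -
  have eq: "{\<bar>A $$ (i, j)\<bar> | i j. i < dim_row A \<and> j < dim_col A}
      = (\<lambda>(i, j). \<bar>A $$ (i, j)\<bar>) ` ({..<dim_row A} \<times> {..<dim_col A})"
    by auto
  have "{..<dim_row A} \<times> {..<dim_col A} \<noteq> {}"
    using assms(1,2) by (auto simp: lessThan_empty_iff)
  with assms(3) show ?thesis
    unfolding max_norm_mat_def eq by (subst Max_le_iff) auto
qed

lemma max_norm_vec_le:
  assumes "1 \<le> dim_vec b" "\<And>i. i < dim_vec b \<Longrightarrow> \<bar>b $ i\<bar> \<le> B"
  shows "max_norm_vec b \<le> B"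
proof -
  have eq: "{\<bar>b $ i\<bar> | i. i < dim_vec b} = (\<lambda>i. \<bar>b $ i\<bar>) ` {..<dim_vec b}"
    by auto
  have "{..<dim_vec b} \<noteq> {}"
    using assms(1) by (auto simp: lessThan_empty_iff)
  with assms(2) show ?thesis
    unfolding max_norm_vec_def eq by (subst Max_le_iff) auto
qed

lemma weight_magnitude_le:
  assumes net: "\<Theta> \<in> networks d d'"
    and A: "\<And>A b i j. (A, b) \<in> set \<Theta> \<Longrightarrow> i < dim_row A \<Longrightarrow> j < dim_col A \<Longrightarrow> \<bar>A $$ (i, j)\<bar> \<le> B"
    and b: "\<And>A b i. (A, b) \<in> set \<Theta> \<Longrightarrow> i < dim_vec b \<Longrightarrow> \<bar>b $ i\<bar> \<le> B"
  shows "weight_magnitude \<Theta> \<le> B"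
proof -
  obtain N where ne: "\<Theta> \<noteq> []" and N: "\<forall>l\<le>length \<Theta>. N l \<ge> 1"
      "\<forall>l<length \<Theta>. fst (\<Theta> ! l) \<in> carrier_mat (N (Suc l)) (N l) \<and> snd (\<Theta> ! l) \<in> carrier_vec (N (Suc l))"
    using net by (auto simp: networks_def)
  have "max (max_norm_mat (fst (\<Theta> ! l))) (max_norm_vec (snd (\<Theta> ! l))) \<le> B" if l: "l < length \<Theta>" for l
  proof -
    have "(fst (\<Theta> ! l), snd (\<Theta> ! l)) \<in> set \<Theta>" using l by simp
    note AB = A[OF this] b[OF this]
    have "1 \<le> N l" "1 \<le> N (Suc l)" using N(1) l by auto
    then have dims: "1 \<le> dim_row (fst (\<Theta> ! l))" "1 \<le> dim_col (fst (\<Theta> ! l))" "1 \<le> dim_vec (snd (\<Theta> ! l))"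
      using N(2) l by auto
    show ?thesis
      by (rule max.boundedI[OF max_norm_mat_le[OF dims(1,2) AB(1)] max_norm_vec_le[OF dims(3) AB(2)]])
  qed
  with ne show ?thesis
    unfolding weight_magnitude_def by (subst Max_le_iff) auto
qed

text \<open>A hat sum as a network with one hidden layer of width \<open>3 * m\<close>: the hat with index
  \<open>j\<close> (from 0) uses the neurons \<open>3 * j + r\<close> for \<open>r < 3\<close>, which are active to the right of
  the left end, the middle and the right end of its support.\<close>

definition hidden_layer :: "nat \<Rightarrow> real mat \<times> real vec" where
  "hidden_layer m = (mat (3 * m) 1 (\<lambda>_. real m), vec (3 * m) (\<lambda>i. - (real (i div 3) + real (i mod 3) / 2)))"

definition output_layer :: "nat \<Rightarrow> (nat \<Rightarrow> real) \<Rightarrow> real mat \<times> real vec" where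
  "output_layer m a =
     (mat 1 (3 * m) (\<lambda>(_, i). a (Suc (i div 3)) * (if i mod 3 = 1 then - 4 else 2)), vec 1 (\<lambda>_. 0))"

text \<open>Each block ends in a layer of width 1, which keeps the number of weights linear in \<open>m\<close>.
  The activation between two blocks acts on a nonnegative number.\<close>

primrec hat_blocks :: "nat \<Rightarrow> (nat \<Rightarrow> nat \<Rightarrow> real) \<Rightarrow> nat \<Rightarrow> network" where
  "hat_blocks m a 0 = []"
| "hat_blocks m a (Suc k) = hat_blocks m a k @ [hidden_layer m, output_layer m (a (Suc k))]"

text \<open>A final layer of width 1 that multiplies by a constant.\<close>

definition scaling_layer :: "real \<Rightarrow> real mat \<times> real vec" where
  "scaling_layer s = (mat 1 1 (\<lambda>_. s), vec 1 (\<lambda>_. 0))"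

lemma sum_div_mod_3:
  "(\<Sum>i<3 * m. g (i div 3) (i mod 3)) = (\<Sum>j<m. g j 0 + g j 1 + g j (2::nat))"
  for g :: "nat \<Rightarrow> nat \<Rightarrow> real"
proof (induction m)
  case (Suc m)
  have "3 * Suc m = Suc (Suc (Suc (3 * m)))" by simp
  moreover have "3 * m div 3 = m" "Suc (3 * m) div 3 = m" "Suc (Suc (3 * m)) div 3 = m"
    "3 * m mod 3 = 0" "Suc (3 * m) mod 3 = 1" "Suc (Suc (3 * m)) mod 3 = 2"
    by presburger+
  ultimately show ?case
    using Suc by (simp only: sum.lessThan_Suc)
qed simp

lemma realization_hat_block:
  assumes "1 \<le> m"
  shows "realization (\<lambda>x. max 0 x) [hidden_layer m, output_layer m a] (vec 1 (\<lambda>_. x)) = vec 1 (\<lambda>_. hat_sum m a x)"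
    (is "realization ?\<rho> _ ?v = _")
proof -
  have hid: "map_vec ?\<rho> (fst (hidden_layer m) *\<^sub>v ?v + snd (hidden_layer m))
      = vec (3 * m) (\<lambda>i. max 0 (real m * x - (real (i div 3) + real (i mod 3) / 2)))"
    by (rule eq_vecI) (auto simp: hidden_layer_def scalar_prod_def)
  have shift: "real m * (x - (real (Suc j) - 1) / real m) = real m * x - real j" for j
    using assms by (simp add: field_simps)
  have "(\<Sum>i<3 * m. a (Suc (i div 3)) * (if i mod 3 = 1 then - 4 else 2)
        * max 0 (real m * x - (real (i div 3) + real (i mod 3) / 2)))
      = (\<Sum>j<m. a (Suc j) * hat (real m * x - real j))"
    by (subst sum_div_mod_3[where g = "\<lambda>j r. a (Suc j) * (if r = 1 then - 4 else 2)
        * max 0 (real m * x - (real j + real r / 2))"])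
      (simp add: hat_eq_relu algebra_simps)
  also have "\<dots> = hat_sum m a x"
    unfolding hat_sum_def One_nat_def sum.atLeast1_atMost_eq shift ..
  finally show ?thesis
    using hid
    by (intro eq_vecI) (auto simp: hidden_layer_def output_layer_def scalar_prod_def atLeast0LessThan)
qed

lemma realization_hat_blocks:
  assumes "1 \<le> m" "\<And>i. i \<in> {1..k} \<Longrightarrow> a i \<in> {1..m} \<rightarrow> {0, 1}" "\<Theta> \<noteq> []"
  shows "realization (\<lambda>x. max 0 x) (hat_blocks m a k @ \<Theta>) (vec 1 (\<lambda>_. x))
      = realization (\<lambda>x. max 0 x) \<Theta> (vec 1 (\<lambda>_. hat_comp m a k x))"
  using assms
proof (induction k arbitrary: \<Theta>)
  case (Suc k)
  have "a (Suc k) \<in> {1..m} \<rightarrow> {0, 1}" by (rule Suc.prems) simp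
  then have "map_vec (\<lambda>x. max 0 x) (vec 1 (\<lambda>_. hat_sum m (a (Suc k)) (hat_comp m a k x)))
      = vec 1 (\<lambda>_. hat_sum m (a (Suc k)) (hat_comp m a k x))"
    by (intro eq_vecI) (auto simp: hat_sum_nonneg)
  moreover have "realization (\<lambda>x. max 0 x) (hat_blocks m a (Suc k) @ \<Theta>) (vec 1 (\<lambda>_. x))
      = realization (\<lambda>x. max 0 x) ([hidden_layer m, output_layer m (a (Suc k))] @ \<Theta>) (vec 1 (\<lambda>_. hat_comp m a k x))"
    unfolding hat_blocks.simps append_assoc using Suc.prems by (intro Suc.IH) auto
  ultimately show ?case
    unfolding realization_append[OF list.distinct(2) Suc.prems(3)] realization_hat_block[OF Suc.prems(1)]
    by simp
qed simp

lemma scalar_realization_hat_net: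
  assumes "1 \<le> m" "\<And>i. i \<in> {1..k} \<Longrightarrow> a i \<in> {1..m} \<rightarrow> {0, 1}"
  shows "scalar_realization (\<lambda>x. max 0 x) (hat_blocks m a k @ [scaling_layer s]) = (\<lambda>x. s * hat_comp m a k x)"
proof
  fix x
  show "scalar_realization (\<lambda>x. max 0 x) (hat_blocks m a k @ [scaling_layer s]) x = s * hat_comp m a k x"
    unfolding scalar_realization_def
    by (subst realization_hat_blocks[OF assms]) (auto simp: scaling_layer_def scalar_prod_def)
qed

lemma length_hat_blocks: "length (hat_blocks m a k) = 2 * k"
  by (induction k) auto

lemma networks_hat_net:
  assumes "1 \<le> m"
  shows "hat_blocks m a k @ [scaling_layer s] \<in> networks 1 1"
proof -
  have "[scaling_layer s] \<in> networks 1 1"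
    unfolding scaling_layer_def by (rule networks_single) auto
  moreover have "[hidden_layer m, output_layer m b] \<in> networks 1 1" for b
  proof -
    have "[hidden_layer m] \<in> networks 1 (3 * m)"
      unfolding hidden_layer_def using assms by (intro networks_single) auto
    moreover have "[output_layer m b] \<in> networks (3 * m) 1"
      unfolding output_layer_def using assms by (intro networks_single) auto
    ultimately show ?thesis using networks_append by fastforce
  qed
  ultimately show ?thesis
  proof (induction k arbitrary: s)
    case (Suc k)
    have "\<Theta> \<in> networks 1 1 \<Longrightarrow> hat_blocks m a j @ \<Theta> \<in> networks 1 1" for j \<Theta>
    proof (induction j arbitrary: \<Theta>)
      case (Suc j)
      show ?case
        unfolding hat_blocks.simps append_assoc
        by (intro Suc.IH networks_append[OF _ Suc.prems] \<open>\<And>b. [hidden_layer m, output_layer m b] \<in> networks 1 1\<close>)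
    qed simp
    with Suc.prems(1) show ?case by blast
  qed simp
qed

lemma connectivity_hat_net:
  assumes "1 \<le> m"
  shows "connectivity (hat_blocks m a k @ [scaling_layer s]) \<le> (10 * k + 2) * m"
proof -
  have "connectivity [scaling_layer s] \<le> 2"
    using nnz_mat_le[of "mat 1 1 (\<lambda>_. s)"] nnz_vec_le[of "vec 1 (\<lambda>_. 0)"]
    by (simp add: scaling_layer_def connectivity_Cons)
  moreover have "connectivity (hat_blocks m a k) \<le> k * (10 * m)"
  proof (induction k)
    case (Suc k)
    have "connectivity [hidden_layer m, output_layer m (a (Suc k))] \<le> 3 * m + 3 * m + 3 * m + 1"
      unfolding hidden_layer_def output_layer_def connectivity_Cons connectivity_Nil
      by (intro order_trans[OF add_mono[OF add_mono[OF nnz_mat_le nnz_vec_le]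
              add_mono[OF add_mono[OF nnz_mat_le nnz_vec_le] order_refl]]]) simp
    with Suc assms show ?case by (simp add: connectivity_append)
  qed simp
  ultimately show ?thesis
    using assms by (simp add: connectivity_append algebra_simps)
qed

lemma weight_magnitude_hat_net:
  assumes "1 \<le> m" "\<And>i. i \<in> {1..k} \<Longrightarrow> a i \<in> {1..m} \<rightarrow> {0, 1}"
    and "real m \<le> B" "4 \<le> B" "\<bar>s\<bar> \<le> B"
  shows "weight_magnitude (hat_blocks m a k @ [scaling_layer s]) \<le> B"
proof (rule weight_magnitude_le[OF networks_hat_net[OF assms(1)]])
  have mem: "l = hidden_layer m \<or> (\<exists>i\<in>{1..k}. l = output_layer m (a i)) \<or> l = scaling_layer s"
    if "l \<in> set (hat_blocks m a k @ [scaling_layer s])" for l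
  proof -
    have "set (hat_blocks m a k) \<subseteq> insert (hidden_layer m) ((\<lambda>i. output_layer m (a i)) ` {1..k})"
      by (induction k) (auto simp: atLeastAtMostSuc_conv)
    with that show ?thesis by auto
  qed
  fix A b
  assume "(A, b) \<in> set (hat_blocks m a k @ [scaling_layer s])"
  note cases = mem[OF this]
  show "\<bar>A $$ (i, j)\<bar> \<le> B" if "i < dim_row A" "j < dim_col A" for i j
  proof -
    have "\<bar>a l (Suc (j div 3)) * (if j mod 3 = 1 then - 4 else 2)\<bar> \<le> B"
      if "l \<in> {1..k}" "j < 3 * m" for l
    proof -
      have "Suc (j div 3) \<le> m" using that(2) by presburger
      then show ?thesis
        using binary_range(1)[OF assms(2)[OF that(1)], of "Suc (j div 3)"] assms(4) by auto
    qed
    with that cases assms show ?thesis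
      by (auto simp: hidden_layer_def output_layer_def scaling_layer_def)
  qed
  show "\<bar>b $ i\<bar> \<le> B" if "i < dim_vec b" for i
  proof -
    have "real (i div 3) + real (i mod 3) / 2 \<le> B" if "i < 3 * m"
    proof -
      have "i div 3 < m" using that by (simp add: less_mult_imp_div_less mult.commute)
      moreover have "i mod 3 < 3" by simp
      ultimately have "real (i div 3) + 1 \<le> real m" "real (i mod 3) \<le> 2" by linarith+
      with assms(3) show ?thesis by linarith
    qed
    with that cases assms show ?thesis
      by (auto simp: hidden_layer_def output_layer_def scaling_layer_def)
  qed
qed

lemma nn_approximants_zero:
  assumes "1 \<le> poly \<pi> (ln (real M))" "0 \<le> poly \<pi> (real M)"
  shows "(\<lambda>x. 0) \<in> nn_approximants \<rho> \<pi> M"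
proof -
  let ?\<Theta> = "[scaling_layer 0]"
  have net: "?\<Theta> \<in> networks 1 1"
    unfolding scaling_layer_def by (rule networks_single) auto
  have A: "nnz_mat A = 0" if "\<forall>i j. i < dim_row A \<longrightarrow> j < dim_col A \<longrightarrow> A $$ (i, j) = 0" for A
  proof -
    have "{(i, j). i < dim_row A \<and> j < dim_col A \<and> A $$ (i, j) \<noteq> 0} = {}"
      using that by blast
    then show ?thesis by (simp only: nnz_mat_def card.empty)
  qed
  have b: "nnz_vec b = 0" if "\<forall>i. i < dim_vec b \<longrightarrow> b $ i = 0" for b
  proof -
    have "{i. i < dim_vec b \<and> b $ i \<noteq> 0} = {}"
      using that by blast
    then show ?thesis by (simp only: nnz_vec_def card.empty)
  qed
  have "nnz_mat (mat 1 1 (\<lambda>_. 0)) = 0"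
    by (rule A) simp
  moreover have "nnz_vec (vec 1 (\<lambda>_. 0)) = 0"
    by (rule b) simp
  ultimately have "connectivity ?\<Theta> = 0"
    by (simp add: scaling_layer_def connectivity_Cons)
  moreover have "weight_magnitude ?\<Theta> \<le> poly \<pi> (real M)"
    using assms by (intro weight_magnitude_le[OF net]) (auto simp: scaling_layer_def)
  moreover have "scalar_realization \<rho> ?\<Theta> = (\<lambda>x. 0)"
    by (auto simp: scalar_realization_def scaling_layer_def scalar_prod_def)
  ultimately show ?thesis
    using net assms unfolding nn_approximants_def
    by (auto simp: depth_def intro!: exI[of _ ?\<Theta>])
qed

text \<open>With \<open>M\<close> weights, the levels \<open>m\<close> up to order \<open>M\<close> are represented exactly, and the members of
  all higher levels have norm \<open>m\<^sup>-\<^sup>\<mu>\<close>, so that the zero network suffices for them.\<close>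

lemma nn_rate_V_class_ge:
  assumes H: "admissible_choice k \<alpha> \<beta> m\<^sub>0 H" and \<mu>: "0 < \<mu>"
  shows "ereal \<mu> \<le> nn_rate (\<lambda>x. max 0 x) (V_class m\<^sub>0 H \<mu>)"
proof -
  define K where "K = 10 * real k + 2"
  define \<pi> :: "real poly" where "\<pi> = monom (4 * 2 ^ k) (2 * k) + monom 1 1 + [:2 * real k + 5:]"
  have K: "1 \<le> K" by (simp add: K_def)
  have \<pi>_eq: "poly \<pi> x = 4 * 2 ^ k * x ^ (2 * k) + x + 2 * real k + 5" for x
    by (simp add: \<pi>_def poly_monom)
  have "\<pi> \<in> nonneg_polys"
    by (auto simp: nonneg_polys_def \<pi>_def coeff_pCons split: nat.splits)
  moreover have "ereal \<mu> \<le> approx_rate (V_class m\<^sub>0 H \<mu>) (nn_approximants (\<lambda>x. max 0 x) \<pi>)"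
  proof (rule approx_rate_ge[OF \<mu>])
    show "0 \<le> K powr \<mu>" by simp
    show "\<forall>\<^sub>F M in sequentially. \<forall>f\<in>V_class m\<^sub>0 H \<mu>. \<exists>h\<in>nn_approximants (\<lambda>x. max 0 x) \<pi> M.
        L2_norm (\<lambda>x. f x - h x) \<le> K powr \<mu> * real M powr (-\<mu>)"
      using eventually_ge_at_top[of 1]
    proof (eventually_elim, intro ballI)
      fix M :: nat and f assume M: "1 \<le> M" and f: "f \<in> V_class m\<^sub>0 H \<mu>"
      from H f obtain m a where m: "1 \<le> m" and a: "a \<in> index_set m k"
        and nz: "L2_norm (hat_comp m a k) \<noteq> 0"
        and f_eq: "f = (\<lambda>x. real m powr (-\<mu>) / L2_norm (hat_comp m a k) * hat_comp m a k x)"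
        and f_norm: "L2_norm f = real m powr (-\<mu>)"
        by (rule V_class_cases)
      define s where "s = real m powr (-\<mu>) / L2_norm (hat_comp m a k)"
      have s: "0 < s" "s \<le> 4 * (2 * (real m)\<^sup>2) ^ k"
        using hat_comp_scaled_bounds(1,2)[OF m a nz less_imp_le[OF \<mu>]] by (auto simp: s_def)
      have lnM: "0 \<le> ln (real M)" using M by simp
      have depth: "2 * real k + 1 \<le> poly \<pi> (ln (real M))"
        using lnM by (simp add: \<pi>_eq)
      show "\<exists>h\<in>nn_approximants (\<lambda>x. max 0 x) \<pi> M. L2_norm (\<lambda>x. f x - h x) \<le> K powr \<mu> * real M powr (-\<mu>)"
      proof (cases "(10 * k + 2) * m \<le> M")
        case True
        let ?\<Theta> = "hat_blocks m a k @ [scaling_layer s]"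
        have mM: "m \<le> M"
          using True by (auto intro: order_trans[rotated])
        have "s \<le> 4 * (2 * (real M)\<^sup>2) ^ k"
          using mM by (intro order_trans[OF s(2)] mult_left_mono power_mono) auto
        also have "\<dots> = 4 * 2 ^ k * real M ^ (2 * k)"
          by (simp add: power_mult_distrib power_mult)
        also have "\<dots> \<le> poly \<pi> (real M)" by (simp add: \<pi>_eq)
        finally have s_le: "s \<le> poly \<pi> (real M)" .
        have "0 \<le> 4 * 2 ^ k * real M ^ (2 * k)" "real m \<le> real M" using mM by simp_all
        then have "real m \<le> poly \<pi> (real M)" "4 \<le> poly \<pi> (real M)"
          unfolding \<pi>_eq by linarith+
        then have "weight_magnitude ?\<Theta> \<le> poly \<pi> (real M)"
          using s s_le by (intro weight_magnitude_hat_net[OF m index_set_D[OF a]]) auto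
        moreover have "f = scalar_realization (\<lambda>x. max 0 x) ?\<Theta>"
          unfolding f_eq s_def[symmetric]
          by (rule scalar_realization_hat_net[OF m index_set_D[OF a], symmetric])
        ultimately have "f \<in> nn_approximants (\<lambda>x. max 0 x) \<pi> M"
          using networks_hat_net[OF m, of a k s] connectivity_hat_net[OF m, of a k s] True depth
          unfolding nn_approximants_def
          by (auto simp: depth_def length_hat_blocks intro!: exI[of _ ?\<Theta>] intro: order_trans)
        moreover have "L2_norm (\<lambda>x. f x - f x) \<le> K powr \<mu> * real M powr (-\<mu>)"
          by (simp add: L2_norm_def L2_inner_def)
        ultimately show ?thesis by blast
      next
        case False
        then have "real M \<le> real ((10 * k + 2) * m)" by linarith
        also have "\<dots> = K * real m" by (simp add: K_def algebra_simps)
        finally have "real M / K \<le> real m"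
          using K by (simp add: field_simps)
        then have "real m powr (-\<mu>) \<le> (real M / K) powr (-\<mu>)"
          using M K \<mu> by (intro powr_mono2') auto
        also have "\<dots> = K powr \<mu> * real M powr (-\<mu>)"
          using K M by (simp add: powr_divide powr_minus field_simps)
        finally have "L2_norm (\<lambda>x. f x - 0) \<le> K powr \<mu> * real M powr (-\<mu>)"
          using f_norm by simp
        moreover have "(\<lambda>x. 0) \<in> nn_approximants (\<lambda>x. max 0 x) \<pi> M"
          using depth by (intro nn_approximants_zero) (auto simp: \<pi>_eq)
        ultimately show ?thesis by (intro bexI[of _ "\<lambda>x. 0"]) auto
      qed
    qed
  qed
  ultimately show ?thesis
    unfolding nn_rate_def by (intro SUP_upper2)
qed


section \<open>Walsh functions\<close>

text \<open>The sign given by the \<open>n\<close>-th binary digit after the point, counted from 0: \<open>1\<close> on the left half of each dyadic interval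
  of length \<open>2\<^sup>-\<^sup>n\<close> and \<open>-1\<close> on the right half.\<close>

definition rademacher :: "nat \<Rightarrow> real \<Rightarrow> real" where
  "rademacher n x = (if even \<lfloor>2 ^ Suc n * x\<rfloor> then 1 else - 1)"

text \<open>Walsh functions are indexed by finite sets of digit positions rather than by numbers, so that
  multiplication becomes the symmetric difference.\<close>

definition walsh :: "nat set \<Rightarrow> real \<Rightarrow> real" where
  "walsh U x = (\<Prod>b\<in>U. rademacher b x)"

lemma floor_dyadic_div: "\<lfloor>2 ^ (n + d) * x\<rfloor> div 2 ^ d = \<lfloor>2 ^ n * x\<rfloor>" for x :: real
  using floor_divide_real_eq_div[of "2 ^ d" "2 ^ (n + d) * x"] by (simp add: power_add)

lemma floor_dyadic_Suc: "\<lfloor>2 ^ Suc n * x\<rfloor> div 2 = \<lfloor>2 ^ n * x\<rfloor>" for x :: real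
  using floor_dyadic_div[of n 1 x] by (simp only: Suc_eq_plus1 power_one_right)

lemma abs_rademacher [simp]: "\<bar>rademacher n x\<bar> = 1"
  by (simp add: rademacher_def)

lemma rademacher_square [simp]: "rademacher n x * rademacher n x = 1"
  by (simp add: rademacher_def)

lemma abs_walsh [simp]: "\<bar>walsh U x\<bar> = 1"
  by (simp add: walsh_def abs_prod)

lemma walsh_insert: "finite U \<Longrightarrow> n \<notin> U \<Longrightarrow> walsh (insert n U) x = rademacher n x * walsh U x"
  by (simp add: walsh_def)

lemma walsh_mult:
  assumes "finite U" "finite V"
  shows "walsh U x * walsh V x = walsh ((U - V) \<union> (V - U)) x"
proof -
  have sq: "walsh (U \<inter> V) x * walsh (U \<inter> V) x = 1"
    by (simp add: walsh_def prod.distrib[symmetric])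
  have "walsh U x = walsh (U - V) x * walsh (U \<inter> V) x"
    using assms unfolding walsh_def by (subst prod.union_disjoint[symmetric]) (auto intro: prod.cong)
  moreover have "walsh V x = walsh (V - U) x * walsh (U \<inter> V) x"
    using assms unfolding walsh_def by (subst prod.union_disjoint[symmetric]) (auto intro: prod.cong)
  moreover have "walsh ((U - V) \<union> (V - U)) x = walsh (U - V) x * walsh (V - U) x"
    using assms unfolding walsh_def by (subst prod.union_disjoint) auto
  ultimately show ?thesis
    using sq by (simp add: mult.assoc mult.left_commute)
qed

lemma walsh_dyadic:
  assumes "U \<subseteq> {..<n}"
  shows "walsh U x = (\<Prod>b\<in>U. if even (\<lfloor>2 ^ n * x\<rfloor> div 2 ^ (n - Suc b)) then 1 else - 1)"
  unfolding walsh_def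
proof (rule prod.cong[OF refl])
  fix b assume "b \<in> U"
  then have "Suc b + (n - Suc b) = n" using assms by auto
  then show "rademacher b x = (if even (\<lfloor>2 ^ n * x\<rfloor> div 2 ^ (n - Suc b)) then 1 else - 1)"
    using floor_dyadic_div[of "Suc b" "n - Suc b" x] by (simp only: rademacher_def)
qed

lemma has_integral_dyadic_step:
  fixes F :: "int \<Rightarrow> real"
  shows "((\<lambda>x. F \<lfloor>2 ^ n * x\<rfloor>) has_integral (\<Sum>i<j. F (int i)) / 2 ^ n) {0..real j / 2 ^ n}"
proof (induction j)
  case 0
  then show ?case by (simp add: has_integral_refl)
next
  case (Suc j)
  let ?a = "real j / 2 ^ n" and ?b = "real (Suc j) / 2 ^ n"
  have ab: "?a \<le> ?b" by (intro divide_right_mono) auto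
  have const: "((\<lambda>x. F (int j)) has_integral (?b - ?a) * F (int j)) {?a..?b}"
    using has_integral_const_real[of "F (int j)" ?a ?b] ab by simp
  have "F \<lfloor>2 ^ n * x\<rfloor> = F (int j)" if "x \<in> {?a..?b} - {?b}" for x
  proof -
    have "?a \<le> x" "x < ?b" using that by auto
    then have "real j \<le> 2 ^ n * x" "2 ^ n * x < real j + 1"
      by (simp_all add: pos_divide_le_eq pos_less_divide_eq mult.commute add.commute)
    then have "\<lfloor>2 ^ n * x\<rfloor> = int j" by (intro floor_unique) auto
    then show ?thesis by simp
  qed
  then have step: "((\<lambda>x. F \<lfloor>2 ^ n * x\<rfloor>) has_integral (?b - ?a) * F (int j)) {?a..?b}"
    by (rule has_integral_spike_finite[OF _ _ const, of "{?b}", rotated]) simp_all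
  have "((\<lambda>x. F \<lfloor>2 ^ n * x\<rfloor>) has_integral (\<Sum>i<j. F (int i)) / 2 ^ n + (?b - ?a) * F (int j)) {0..?b}"
    by (rule has_integral_combine[OF _ ab Suc step]) simp
  then show ?case
    by (simp add: field_simps)
qed

lemma borel_measurable_dyadic_step:
  fixes F :: "int \<Rightarrow> real"
  shows "(\<lambda>x. F \<lfloor>2 ^ n * x\<rfloor>) \<in> borel_measurable unit_measure"
proof -
  have "(\<lambda>x::real. F \<lfloor>2 ^ n * x\<rfloor>) \<in> borel_measurable borel"
    by (rule measurable_compose[where N = "count_space UNIV"]) measurable
  then have "(\<lambda>x::real. F \<lfloor>2 ^ n * x\<rfloor>) \<in> borel_measurable lebesgue"
    by (intro measurable_completion) simp
  then show ?thesis by (rule measurable_restrict_space1)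
qed

lemma walsh_L2:
  assumes "finite U"
  shows "walsh U \<in> L2"
proof -
  obtain n where n: "U \<subseteq> {..<n}"
    using assms finite_nat_iff_bounded by auto
  have "walsh U \<in> borel_measurable unit_measure"
    using borel_measurable_dyadic_step[of "\<lambda>j. \<Prod>b\<in>U. if even (j div 2 ^ (n - Suc b)) then 1 else - 1" n]
    by (simp only: walsh_dyadic[OF n, symmetric])
  then show ?thesis
    by (rule L2_bounded[where B = 1]) simp
qed

text \<open>With \<open>n\<close> the largest element of \<open>U\<close>, the function changes sign between the two halves of
  each dyadic interval of length \<open>2\<^sup>-\<^sup>n\<close>.\<close>

lemma integral_walsh:
  assumes "finite U" "U \<noteq> {}"
  shows "(LINT x|unit_measure. walsh U x) = 0"
proof -
  define n where "n = Max U"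
  define U' where "U' = U - {n}"
  have "n \<in> U" unfolding n_def by (rule Max_in[OF assms])
  then have U: "U = insert n U'" "n \<notin> U'" "finite U'"
    using assms(1) by (auto simp: U'_def)
  have U'n: "U' \<subseteq> {..<n}"
    using Max_ge[OF assms(1)] unfolding U'_def n_def by (auto intro: le_neq_implies_less)
  define G where "G j = (if even j then 1 else - 1) *
    (\<Prod>b\<in>U'. if even ((j div 2) div 2 ^ (n - Suc b)) then 1 else - 1 :: real)" for j :: int
  have eq: "walsh U x = G \<lfloor>2 ^ Suc n * x\<rfloor>" for x
    unfolding U(1) walsh_insert[OF U(3,2)] walsh_dyadic[OF U'n] G_def floor_dyadic_Suc rademacher_def ..
  have "(\<Sum>i<2 * K. G (int i)) = 0" for K
    by (induction K) (auto simp: G_def)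
  from this[of "2 ^ n"] have "((\<lambda>x. walsh U x) has_integral 0) {0..1}"
    using has_integral_dyadic_step[of G "Suc n" "2 ^ Suc n"] by (simp add: eq)
  moreover have "integrable unit_measure (walsh U)"
  proof -
    have "walsh U = (\<lambda>x. walsh U x * walsh {} x)" by (rule ext) (simp add: walsh_def)
    then show ?thesis
      using integrable_L2_mult[OF walsh_L2[OF assms(1)] walsh_L2[of "{}"]] by simp
  qed
  ultimately show ?thesis
    by (simp add: lebesgue_integral_eq_integral integral_unique)
qed

lemma walsh_orthonormal:
  assumes "finite U" "finite V"
  shows "L2_inner (walsh U) (walsh V) = (if U = V then 1 else 0)"
proof (cases "U = V")
  case True
  then have "L2_inner (walsh U) (walsh V) = (LINT x|unit_measure. 1)"
    using walsh_mult[of V V] assms by (simp add: L2_inner_def walsh_def)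
  also have "\<dots> = 1" by (simp add: measure_restrict_space)
  finally show ?thesis using True by simp
next
  case False
  then have "(U - V) \<union> (V - U) \<noteq> {}" by auto
  then show ?thesis
    using False assms integral_walsh[of "(U - V) \<union> (V - U)"] by (simp add: L2_inner_def walsh_mult)
qed

text \<open>Refining the grid once, a step function is split into its mean and its half difference on
  each pair of neighbouring cells; the latter is multiplied by a Rademacher function. This keeps
  the coefficients bounded by the sup norm.\<close>

lemma dyadic_step_walsh_sum:
  fixes F :: "int \<Rightarrow> real"
  assumes "\<And>j. \<bar>F j\<bar> \<le> B"
  shows "\<exists>c. (\<forall>U. \<bar>c U\<bar> \<le> B) \<and>
    (\<forall>x\<in>{0..<1}. F \<lfloor>2 ^ n * x\<rfloor> = (\<Sum>U\<in>Pow {..<n}. c U * walsh U x))"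
  using assms
proof (induction n arbitrary: F)
  case 0
  have "\<lfloor>x\<rfloor> = 0" if "x \<in> {0..<1}" for x :: real
    using that by (auto simp: floor_eq_iff)
  then show ?case
    using 0 by (intro exI[of _ "\<lambda>_. F 0"]) (auto simp: walsh_def)
next
  case (Suc n)
  have half: "\<bar>(F i + F j) / 2\<bar> \<le> B" "\<bar>(F i - F j) / 2\<bar> \<le> B" for i j
    using Suc.prems[of i] Suc.prems[of j] by (auto simp: abs_le_iff field_simps)
  from Suc.IH[OF half(1), of "\<lambda>i. 2 * i" "\<lambda>i. 2 * i + 1"]
  obtain c where c: "\<forall>U. \<bar>c U\<bar> \<le> B" "\<And>x. x \<in> {0..<1} \<Longrightarrow>
      (F (2 * \<lfloor>2 ^ n * x\<rfloor>) + F (2 * \<lfloor>2 ^ n * x\<rfloor> + 1)) / 2 = (\<Sum>U\<in>Pow {..<n}. c U * walsh U x)"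
    by blast
  from Suc.IH[OF half(2), of "\<lambda>i. 2 * i" "\<lambda>i. 2 * i + 1"]
  obtain d where d: "\<forall>U. \<bar>d U\<bar> \<le> B" "\<And>x. x \<in> {0..<1} \<Longrightarrow>
      (F (2 * \<lfloor>2 ^ n * x\<rfloor>) - F (2 * \<lfloor>2 ^ n * x\<rfloor> + 1)) / 2 = (\<Sum>U\<in>Pow {..<n}. d U * walsh U x)"
    by blast
  define e where "e U = (if n \<in> U then d (U - {n}) else c U)" for U
  have "F \<lfloor>2 ^ Suc n * x\<rfloor> = (\<Sum>U\<in>Pow {..<Suc n}. e U * walsh U x)" if x: "x \<in> {0..<1}" for x
  proof -
    let ?j = "\<lfloor>2 ^ Suc n * x\<rfloor>"
    have j: "\<lfloor>2 ^ n * x\<rfloor> = ?j div 2"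
      by (rule floor_dyadic_Suc[symmetric])
    have split: "F i = (F (2 * (i div 2)) + F (2 * (i div 2) + 1)) / 2
        + (if even i then 1 else - 1) * ((F (2 * (i div 2)) - F (2 * (i div 2) + 1)) / 2)" for i
    proof (cases "even i")
      case False
      then have "i = 2 * (i div 2) + 1" by simp
      with False show ?thesis by (simp add: field_simps)
    qed (simp add: field_simps)
    have "F ?j = (F (2 * (?j div 2)) + F (2 * (?j div 2) + 1)) / 2
        + rademacher n x * ((F (2 * (?j div 2)) - F (2 * (?j div 2) + 1)) / 2)"
      unfolding rademacher_def by (rule split)
    also have "\<dots> = (\<Sum>U\<in>Pow {..<n}. c U * walsh U x) + (\<Sum>U\<in>Pow {..<n}. d U * (rademacher n x * walsh U x))"
      using c(2)[OF x] d(2)[OF x] unfolding j by (simp add: sum_distrib_left mult.left_commute)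
    also have "(\<Sum>U\<in>Pow {..<n}. c U * walsh U x) = (\<Sum>U\<in>Pow {..<n}. e U * walsh U x)"
      by (rule sum.cong) (auto simp: e_def)
    also have "(\<Sum>U\<in>Pow {..<n}. d U * (rademacher n x * walsh U x)) = (\<Sum>U\<in>insert n ` Pow {..<n}. e U * walsh U x)"
    proof -
      have "d U * (rademacher n x * walsh U x) = e (insert n U) * walsh (insert n U) x"
        if "U \<in> Pow {..<n}" for U
      proof -
        have "finite U" "n \<notin> U" using that by (auto intro: finite_subset)
        then show ?thesis by (simp add: walsh_insert e_def)
      qed
      moreover have "inj_on (insert n) (Pow {..<n})"
        by (intro inj_onI) (metis PowD insert_ident lessThan_iff less_irrefl subsetD)
      ultimately show ?thesis by (simp add: sum.reindex)
    qed
    also have "(\<Sum>U\<in>Pow {..<n}. e U * walsh U x) + (\<Sum>U\<in>insert n ` Pow {..<n}. e U * walsh U x)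
        = (\<Sum>U\<in>Pow {..<Suc n}. e U * walsh U x)"
      unfolding lessThan_Suc Pow_insert by (subst sum.union_disjoint) auto
    finally show ?thesis .
  qed
  moreover have "\<bar>e U\<bar> \<le> B" for U
    using c(1) d(1) by (simp add: e_def)
  ultimately show ?case by blast
qed

lemma walsh_approx:
  assumes "f \<in> L2" "0 \<le> B" "0 \<le> L"
    and B: "\<And>x. x \<in> {0..1} \<Longrightarrow> \<bar>f x\<bar> \<le> B"
    and L: "\<And>x y. x \<in> {0..1} \<Longrightarrow> y \<in> {0..1} \<Longrightarrow> \<bar>f x - f y\<bar> \<le> L * \<bar>x - y\<bar>"
  obtains c where "\<And>U. \<bar>c U\<bar> \<le> B"
    "L2_norm (\<lambda>x. f x - (\<Sum>U\<in>Pow {..<n}. c U * walsh U x)) \<le> L / 2 ^ n"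
proof -
  define F where "F j = (if 0 \<le> j \<and> j < 2 ^ n then f (real_of_int j / 2 ^ n) else 0)" for j :: int
  have "\<bar>F j\<bar> \<le> B" for j
  proof -
    have "real_of_int j \<le> 2 ^ n" if "j < 2 ^ n"
      using that by (metis less_imp_le of_int_le_numeral_power_cancel_iff)
    then show ?thesis
      using assms(2) by (auto simp: F_def field_simps intro!: B)
  qed
  then obtain c where c: "\<forall>U. \<bar>c U\<bar> \<le> B"
      "\<And>x. x \<in> {0..<1} \<Longrightarrow> F \<lfloor>2 ^ n * x\<rfloor> = (\<Sum>U\<in>Pow {..<n}. c U * walsh U x)"
    using dyadic_step_walsh_sum[of F B n] by blast
  show thesis
  proof (rule that)
    show "\<bar>c U\<bar> \<le> B" for U using c(1) by simp
    show "L2_norm (\<lambda>x. f x - (\<Sum>U\<in>Pow {..<n}. c U * walsh U x)) \<le> L / 2 ^ n"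
    proof (rule L2_norm_le)
      show "(\<lambda>x. f x - (\<Sum>U\<in>Pow {..<n}. c U * walsh U x)) \<in> L2"
        using assms(1) by (intro L2_diff L2_sum L2_cmult walsh_L2) (auto intro: finite_subset)
      show "0 \<le> L / 2 ^ n" using assms(3) by simp
      fix x :: real assume x: "x \<in> {0..<1}"
      define j where "j = \<lfloor>2 ^ n * x\<rfloor>"
      have j: "real_of_int j \<le> 2 ^ n * x" "2 ^ n * x < real_of_int j + 1"
        unfolding j_def by linarith+
      have j0: "0 \<le> j" using x by (simp add: j_def)
      have "real_of_int j < 2 ^ n" using j(1) x by (intro le_less_trans[OF j(1)]) simp
      then have j1: "j < 2 ^ n" by (metis of_int_less_numeral_power_cancel_iff)
      have "x \<le> (real_of_int j + 1) / 2 ^ n"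
        using j by (simp add: pos_le_divide_eq mult.commute)
      then have y: "real_of_int j / 2 ^ n \<le> x" "x - real_of_int j / 2 ^ n \<le> 1 / 2 ^ n" "0 \<le> real_of_int j / 2 ^ n"
        using j j0 by (auto simp: pos_divide_le_eq mult.commute add_divide_distrib)
      have x01: "x \<in> {0..1}" "real_of_int j / 2 ^ n \<in> {0..1}"
        using x y(1,3) unfolding atLeastAtMost_iff atLeastLessThan_iff by linarith+
      have "\<bar>f x - F j\<bar> \<le> L * \<bar>x - real_of_int j / 2 ^ n\<bar>"
        using L[OF x01] j0 j1 by (simp add: F_def)
      also have "\<dots> \<le> L * (1 / 2 ^ n)"
        using y assms(3) by (intro mult_left_mono) auto
      finally show "\<bar>f x - (\<Sum>U\<in>Pow {..<n}. c U * walsh U x)\<bar> \<le> L / 2 ^ n"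
        using c(2)[OF x] by (simp add: j_def)
    qed
  qed
qed


section \<open>Positivity of the Riesz rate\<close>

text \<open>The Walsh functions as a dictionary: the index \<open>i \<ge> 1\<close> stands for the set of the binary digits
  of \<open>i - 1\<close>, so that the first \<open>2 ^ n\<close> functions span the step functions on dyadic intervals of
  length \<open>2\<^sup>-\<^sup>n\<close>.\<close>

definition walsh_dict :: "nat \<Rightarrow> real \<Rightarrow> real" where
  "walsh_dict i = walsh (set_decode (i - 1))"

lemma walsh_dict_riesz: "riesz_dictionary 1 {1..} walsh_dict"
  unfolding riesz_dictionary_def
proof (intro conjI ballI allI impI)
  show "walsh_dict i \<in> L2" for i
    by (simp add: walsh_dict_def walsh_L2)
  show "L2_norm (walsh_dict i) = 1" for i
    by (simp add: walsh_dict_def L2_norm_def walsh_orthonormal)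
  have orth: "L2_inner (walsh_dict i) (walsh_dict j) = (if i = j then 1 else 0)"
    if "i \<in> {1..}" "j \<in> {1..}" for i j
  proof -
    have "set_decode (i - 1) = set_decode (j - 1) \<longleftrightarrow> i - 1 = j - 1"
      by (metis set_decode_inverse)
    with that show ?thesis
      by (auto simp: walsh_dict_def walsh_orthonormal)
  qed
  fix a :: "nat \<Rightarrow> real"
  assume fin: "finite {i \<in> {1..}. a i \<noteq> 0}"
  let ?I = "{i \<in> {1..}. a i \<noteq> 0}"
  have "L2_inner (\<lambda>x. \<Sum>i\<in>?I. a i * walsh_dict i x) (\<lambda>x. \<Sum>i\<in>?I. a i * walsh_dict i x)
      = (\<Sum>i\<in>?I. \<Sum>j\<in>?I. a i * (a j * L2_inner (walsh_dict i) (walsh_dict j)))"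
    by (subst L2_inner_sum_left, force simp: walsh_dict_def walsh_L2,
        force simp: walsh_dict_def walsh_L2, subst L2_inner_sum_right)
      (auto simp: walsh_dict_def walsh_L2 L2_inner_cmult_left L2_inner_cmult_right)
  also have "\<dots> = (\<Sum>i\<in>?I. \<Sum>j\<in>?I. if i = j then a i * a j else 0)"
    by (intro sum.cong refl) (auto simp: orth)
  also have "\<dots> = (\<Sum>i\<in>?I. \<bar>a i\<bar>\<^sup>2)"
    using fin by (simp add: power2_eq_square)
  finally show "1 * (\<Sum>i\<in>?I. \<bar>a i\<bar>\<^sup>2) \<le> (L2_norm (\<lambda>x. \<Sum>i\<in>?I. a i * walsh_dict i x))\<^sup>2"
    by (simp only: L2_norm_power2 mult_1)
qed

lemma walsh_sum_approximant:
  assumes "2 ^ n \<le> M" "\<And>U. \<bar>c U\<bar> \<le> real M"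
  shows "(\<lambda>x. \<Sum>U\<in>Pow {..<n}. c U * walsh U x) \<in> riesz_approximants {1..} walsh_dict (monom 1 1) M"
proof -
  let ?e = "\<lambda>U. Suc (set_encode U)"
  define I where "I = ?e ` Pow {..<n}"
  have "inj_on set_encode (Pow {..<n})"
    by (rule inj_on_subset[OF inj_on_set_encode]) (auto intro: finite_subset)
  then have inj: "inj_on ?e (Pow {..<n})"
    by (auto simp: inj_on_def)
  have "I \<subseteq> {1..M}"
  proof
    fix i assume "i \<in> I"
    then obtain U where U: "U \<subseteq> {..<n}" "i = ?e U" by (auto simp: I_def)
    have "set_encode U \<le> (\<Sum>b<n. 2 ^ b)"
      unfolding set_encode_def using U(1) by (intro sum_mono2) auto
    also have "\<dots> < 2 ^ n"
      using sum_power2[of n] by (simp add: atLeast0LessThan)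
    finally show "i \<in> {1..M}" using U(2) assms(1) by simp
  qed
  moreover have "card I \<le> M"
    using card_image_le[of "Pow {..<n}" ?e] assms(1) by (simp add: I_def card_Pow)
  moreover have "(\<Sum>U\<in>Pow {..<n}. c U * walsh U x) = (\<Sum>i\<in>I. c (set_decode (i - 1)) * walsh_dict i x)" for x
  proof -
    have "(\<Sum>i\<in>I. c (set_decode (i - 1)) * walsh_dict i x)
        = (\<Sum>U\<in>Pow {..<n}. c (set_decode (set_encode U)) * walsh (set_decode (set_encode U)) x)"
      unfolding I_def by (subst sum.reindex[OF inj]) (simp add: walsh_dict_def)
    also have "\<dots> = (\<Sum>U\<in>Pow {..<n}. c U * walsh U x)"
      by (intro sum.cong refl) (metis PowD finite_lessThan finite_subset set_encode_inverse)
    finally show ?thesis by simp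
  qed
  ultimately show ?thesis
    unfolding riesz_approximants_def using assms(2)
    by (auto simp: poly_monom intro!: exI[of _ I] exI[of _ "\<lambda>i. c (set_decode (i - 1))"])
qed

text \<open>This is what rules out the value \<open>-\<infinity>\<close>. Low levels are approximated by step functions, high levels
  by 0; the two regimes are separated by comparing the Lipschitz constant with \<open>sqrt M\<close>.\<close>

lemma riesz_rate_V_class_ge_0:
  assumes H: "admissible_choice k \<alpha> \<beta> m\<^sub>0 H" and k: "1 \<le> k" and \<mu>: "0 < \<mu>"
  shows "0 \<le> riesz_rate (V_class m\<^sub>0 H \<mu>)"
proof -
  define p where "p = \<mu> / (8 * real k)"
  define K :: real where "K = 16 * 2 ^ (4 * k)"
  define \<gamma> where "\<gamma> = min (1/2) p"
  have p: "0 < p" and \<gamma>: "0 < \<gamma>" "\<gamma> \<le> 1/2" "\<gamma> \<le> p"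
    using k \<mu> by (auto simp: p_def \<gamma>_def)
  have K: "0 < K" by (simp add: K_def)
  have pos: "0 < K powr p" using K by simp
  have "ereal \<gamma> \<le> approx_rate (V_class m\<^sub>0 H \<mu>) (riesz_approximants {1..} walsh_dict (monom 1 1))"
  proof (rule approx_rate_ge[OF \<gamma>(1)])
    show "0 \<le> 2 + K powr p" using pos by simp
    show "\<forall>\<^sub>F M in sequentially. \<forall>f\<in>V_class m\<^sub>0 H \<mu>. \<exists>h\<in>riesz_approximants {1..} walsh_dict (monom 1 1) M.
        L2_norm (\<lambda>x. f x - h x) \<le> (2 + K powr p) * real M powr (-\<gamma>)"
      using eventually_ge_at_top[of 1]
    proof (eventually_elim, intro ballI)
      fix M :: nat and f assume M: "1 \<le> M" and f: "f \<in> V_class m\<^sub>0 H \<mu>"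
      from H f obtain m a where m: "1 \<le> m" and a: "a \<in> index_set m k"
        and nz: "L2_norm (hat_comp m a k) \<noteq> 0"
        and f_eq: "f = (\<lambda>x. real m powr (-\<mu>) / L2_norm (hat_comp m a k) * hat_comp m a k x)"
        and f_L2: "f \<in> L2" and f_norm: "L2_norm f = real m powr (-\<mu>)"
        by (rule V_class_cases)
      define \<Lambda> where "\<Lambda> = (2 * (real m)\<^sup>2) ^ k"
      have m_le: "real m \<le> 2 * (real m)\<^sup>2"
        using m by (simp add: power2_eq_square)
      also have "\<dots> \<le> \<Lambda>"
        unfolding \<Lambda>_def using m_le m k by (intro self_le_power) auto
      finally have \<Lambda>: "real m \<le> \<Lambda>" .
      show "\<exists>h\<in>riesz_approximants {1..} walsh_dict (monom 1 1) M.
          L2_norm (\<lambda>x. f x - h x) \<le> (2 + K powr p) * real M powr (-\<gamma>)"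
      proof (cases "4 * \<Lambda>\<^sup>2 \<le> sqrt (real M)")
        case True
        obtain n where n: "2 ^ n \<le> M" "M < 2 ^ Suc n"
          using ex_power_ivl1[of 2 M] M by auto
        have fB: "\<bar>f x\<bar> \<le> 4 * \<Lambda>\<^sup>2" if "x \<in> {0..1}" for x
        proof -
          have "\<bar>f x\<bar> \<le> 4 * \<Lambda> * real m"
            using hat_comp_scaled_bounds(3)[OF m a nz less_imp_le[OF \<mu>] that] by (simp add: f_eq \<Lambda>_def)
          also have "\<dots> \<le> 4 * \<Lambda>\<^sup>2"
            using \<Lambda> m by (simp add: power2_eq_square)
          finally show ?thesis .
        qed
        have fL: "\<bar>f x - f y\<bar> \<le> 4 * \<Lambda>\<^sup>2 * \<bar>x - y\<bar>" for x y
          using hat_comp_scaled_bounds(4)[OF m a nz less_imp_le[OF \<mu>]] by (simp add: f_eq \<Lambda>_def)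
        obtain c where c: "\<And>U. \<bar>c U\<bar> \<le> 4 * \<Lambda>\<^sup>2"
          "L2_norm (\<lambda>x. f x - (\<Sum>U\<in>Pow {..<n}. c U * walsh U x)) \<le> 4 * \<Lambda>\<^sup>2 / 2 ^ n"
          using walsh_approx[OF f_L2 _ _ fB fL, of n] by auto
        have "sqrt (real M) \<le> real M"
          using M by (intro real_le_lsqrt) (auto simp: power2_eq_square)
        then have "\<bar>c U\<bar> \<le> real M" for U
          using c(1)[of U] True by linarith
        note s = walsh_sum_approximant[OF n(1), of c, OF this]
        have "real M \<le> 2 * 2 ^ n"
          using n(2) by (metis less_imp_le of_nat_le_numeral_power_cancel_iff power_Suc)
        have "4 * \<Lambda>\<^sup>2 / 2 ^ n \<le> sqrt (real M) / (real M / 2)"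
          using True M \<open>real M \<le> 2 * 2 ^ n\<close> by (intro frac_le) auto
        also have "\<dots> = 2 * real M powr (- (1/2))"
          using M by (simp add: powr_minus powr_half_sqrt field_simps)
        also have "\<dots> \<le> 2 * real M powr (-\<gamma>)"
          using M \<gamma> by (intro mult_left_mono powr_mono) auto
        also have "\<dots> \<le> (2 + K powr p) * real M powr (-\<gamma>)"
          using pos by (intro mult_right_mono) auto
        finally show ?thesis
          using s c(2) by (intro bexI[OF _ s]) linarith
      next
        case False
        then have "(sqrt (real M))\<^sup>2 \<le> (4 * \<Lambda>\<^sup>2)\<^sup>2"
          by (intro power_mono) auto
        then have "real M \<le> (4 * \<Lambda>\<^sup>2)\<^sup>2" by simp
        also have "\<dots> = K * real m ^ (8 * k)"
          by (simp add: K_def \<Lambda>_def power_mult_distrib power_mult[symmetric] mult.commute)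
        finally have "real M / K \<le> real m ^ (8 * k)"
          using K by (simp add: field_simps)
        then have "(real m ^ (8 * k)) powr (-p) \<le> (real M / K) powr (-p)"
          using M K p by (intro powr_mono2') auto
        moreover have "(real m ^ (8 * k)) powr (-p) = real m powr (-\<mu>)"
          using m k by (simp add: powr_realpow[symmetric] powr_powr p_def)
        moreover have "(real M / K) powr (-p) = K powr p * real M powr (-p)"
          using K M by (simp add: powr_divide powr_minus field_simps)
        moreover have "K powr p * real M powr (-p) \<le> (2 + K powr p) * real M powr (-\<gamma>)"
          using M \<gamma> pos by (intro mult_mono powr_mono) auto
        ultimately have "L2_norm (\<lambda>x. f x - 0) \<le> (2 + K powr p) * real M powr (-\<gamma>)"
          using f_norm by simp
        moreover have "(\<lambda>x. 0) \<in> riesz_approximants {1..} walsh_dict (monom 1 1) M"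
          unfolding riesz_approximants_def by (auto intro!: exI[of _ "{}"])
        ultimately show ?thesis by (intro bexI[of _ "\<lambda>x. 0"]) auto
      qed
    qed
  qed
  also have "\<dots> \<le> riesz_rate (V_class m\<^sub>0 H \<mu>)"
    unfolding riesz_rate_def
    using walsh_dict_riesz
    by (intro Sup_upper) (auto simp: nonneg_polys_def coeff_monom simp del: One_nat_def
        intro!: exI[of _ "1::real"] exI[of _ "{1..}"] exI[of _ walsh_dict] exI[of _ "monom 1 1"])
  finally have le: "ereal \<gamma> \<le> riesz_rate (V_class m\<^sub>0 H \<mu>)" .
  have "0 \<le> ereal \<gamma>" using \<gamma>(1) by simp
  then show ?thesis using le by (rule order_trans)
qed


section \<open>Upper bound for the Riesz rate\<close>

lemma finite_hat_comps: "finite (hat_comps m k)"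
proof -
  have "finite (index_set m k)"
    unfolding index_set_def by (intro finite_PiE) auto
  then show ?thesis
    by (simp add: hat_comps_def setcompr_eq_image)
qed

text \<open>An almost orthonormal family of more than \<open>2 / \<tau>\<^sup>2\<close> vectors cannot have inner products of
  size \<open>\<tau>\<close> with one unit vector: the signed sum of the family would be too short.\<close>

lemma card_correlated_le:
  assumes fin: "finite A" and g: "\<And>h. h \<in> A \<Longrightarrow> g h \<in> L2" "\<And>h. h \<in> A \<Longrightarrow> L2_norm (g h) = 1"
    and coh: "\<And>h h'. h \<in> A \<Longrightarrow> h' \<in> A \<Longrightarrow> h \<noteq> h' \<Longrightarrow> \<bar>L2_inner (g h) (g h')\<bar> \<le> \<nu>"
    and \<phi>: "\<phi> \<in> L2" "L2_norm \<phi> = 1"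
    and \<tau>: "0 < \<tau>" "\<And>h. h \<in> A \<Longrightarrow> \<tau> \<le> \<bar>L2_inner (g h) \<phi>\<bar>"
    and \<nu>: "0 \<le> \<nu>" "\<nu> \<le> \<tau>\<^sup>2 / 2"
  shows "real (card A) \<le> 2 / \<tau>\<^sup>2"
proof -
  define \<sigma> where "\<sigma> h = sgn (L2_inner (g h) \<phi>)" for h
  define v where "v = (\<lambda>x. \<Sum>h\<in>A. \<sigma> h * g h x)"
  define n where "n = real (card A)"
  have v: "v \<in> L2" unfolding v_def using g(1) by (intro L2_sum L2_cmult)
  have "n * \<tau> = (\<Sum>h\<in>A. \<tau>)" by (simp add: n_def)
  also have "\<dots> \<le> (\<Sum>h\<in>A. \<bar>L2_inner (g h) \<phi>\<bar>)"
    using \<tau>(2) by (rule sum_mono)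
  also have "\<dots> = (\<Sum>h\<in>A. \<sigma> h * L2_inner (g h) \<phi>)"
    by (simp add: \<sigma>_def abs_sgn mult.commute)
  also have "\<dots> = L2_inner v \<phi>"
    unfolding v_def using g(1) \<phi>(1) by (subst L2_inner_sum_left) (auto simp: L2_inner_cmult_left)
  also have "\<dots> \<le> L2_norm v"
    using L2_Cauchy_Schwarz[OF v \<phi>(1)] \<phi>(2) by simp
  finally have "(n * \<tau>)\<^sup>2 \<le> (L2_norm v)\<^sup>2"
    using \<tau>(1) by (intro power_mono) (auto simp: n_def)
  also have "\<dots> = (\<Sum>h\<in>A. L2_inner (\<lambda>x. \<sigma> h * g h x) v)"
    unfolding L2_norm_power2 using g(1) v
    by (subst (1) v_def, subst L2_inner_sum_left) auto
  also have "\<dots> = (\<Sum>h\<in>A. \<Sum>h'\<in>A. \<sigma> h * (\<sigma> h' * L2_inner (g h) (g h')))"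
  proof (rule sum.cong[OF refl])
    fix h assume h: "h \<in> A"
    have "L2_inner (g h) v = (\<Sum>h'\<in>A. \<sigma> h' * L2_inner (g h) (g h'))"
      unfolding v_def using g(1) h by (subst L2_inner_sum_right) (auto simp: L2_inner_cmult_right)
    then show "L2_inner (\<lambda>x. \<sigma> h * g h x) v = (\<Sum>h'\<in>A. \<sigma> h * (\<sigma> h' * L2_inner (g h) (g h')))"
      by (simp add: L2_inner_cmult_left sum_distrib_left)
  qed
  also have "\<dots> \<le> (\<Sum>h\<in>A. \<Sum>h'\<in>A. (if h = h' then 1 else 0) + \<nu>)"
  proof (intro sum_mono)
    fix h h' assume h: "h \<in> A" "h' \<in> A"
    have sg: "\<bar>\<sigma> h\<bar> \<le> 1" for h by (simp add: \<sigma>_def abs_sgn_eq)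
    have "\<sigma> h * (\<sigma> h' * L2_inner (g h) (g h')) \<le> \<bar>\<sigma> h * \<sigma> h'\<bar> * \<bar>L2_inner (g h) (g h')\<bar>"
      by (metis abs_ge_self abs_mult mult.assoc)
    also have "\<dots> \<le> 1 * \<bar>L2_inner (g h) (g h')\<bar>"
      using mult_mono[OF sg[of h] sg[of h']] by (intro mult_right_mono) (auto simp: abs_mult)
    also have "\<dots> \<le> (if h = h' then 1 else 0) + \<nu>"
      using coh[OF h] g(2)[OF h(1)] \<nu>(1) L2_norm_power2[of "g h"] by (cases "h = h'") auto
    finally show "\<sigma> h * (\<sigma> h' * L2_inner (g h) (g h')) \<le> (if h = h' then 1 else 0) + \<nu>" .
  qed
  also have "\<dots> = n + n\<^sup>2 * \<nu>"
    using fin by (simp add: n_def sum.distrib power2_eq_square algebra_simps)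
  also have "\<dots> \<le> n + n\<^sup>2 * (\<tau>\<^sup>2 / 2)"
    using \<nu>(2) by (intro add_left_mono mult_left_mono) auto
  finally have *: "n * (n * \<tau>\<^sup>2) \<le> n * 2"
    by (simp add: power2_eq_square algebra_simps)
  show ?thesis
  proof (cases "n = 0")
    case True
    then show ?thesis by (simp add: n_def)
  next
    case False
    then have "0 < n" by (simp add: n_def)
    with * have "n * \<tau>\<^sup>2 \<le> 2" by simp
    then show ?thesis
      using \<tau>(1) by (simp add: n_def pos_le_divide_eq)
  qed
qed

text \<open>A unit vector close to a combination of \<open>M\<close> atoms of a Riesz dictionary correlates with one
  of them. The constant 5 leaves room for a strict inequality; any number above 4 would do.\<close>

lemma correlated_atom:
  assumes D: "riesz_dictionary c T \<phi>" and c: "0 < c"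
    and g: "g \<in> L2" "L2_norm g = 1"
    and I: "finite I" "I \<subseteq> T" "card I \<le> M" and M: "1 \<le> M"
    and approx: "L2_norm (\<lambda>x. g x - (\<Sum>i\<in>I. b i * \<phi> i x)) \<le> 1/2"
  shows "\<exists>i\<in>I. sqrt c / 5 / sqrt (real M) \<le> \<bar>L2_inner g (\<phi> i)\<bar>"
proof (rule ccontr)
  define t where "t = sqrt c / 5 / sqrt (real M)"
  assume "\<not> ?thesis"
  then have small: "\<bar>L2_inner g (\<phi> i)\<bar> \<le> t" if "i \<in> I" for i
    using that by (auto simp: t_def not_le intro: less_imp_le)
  have \<phi>: "\<phi> i \<in> L2" if "i \<in> I" for i
    using D I(2) that by (auto simp: riesz_dictionary_def)
  define s where "s = (\<lambda>x. \<Sum>i\<in>I. b i * \<phi> i x)"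
  have s: "s \<in> L2" unfolding s_def using \<phi> by (intro L2_sum L2_cmult)
  have "L2_norm s \<le> 3 / 2"
    using L2_norm_triangle[OF g(1) s] g(2) approx by (simp add: s_def)
  then have s2: "(L2_norm s)\<^sup>2 \<le> 9 / 4"
    using power_mono[of "L2_norm s" "3/2" 2] L2_norm_nonneg[of s] by (simp add: power2_eq_square)
  define a where "a i = (if i \<in> I then b i else 0)" for i
  have supp: "{i \<in> T. a i \<noteq> 0} = {i \<in> I. b i \<noteq> 0}"
    using I(2) by (auto simp: a_def)
  have "finite {i \<in> T. a i \<noteq> 0}"
    unfolding supp using I(1) by simp
  then have "c * (\<Sum>i\<in>{i \<in> T. a i \<noteq> 0}. \<bar>a i\<bar>\<^sup>2) \<le> (L2_norm (\<lambda>x. \<Sum>i\<in>{i \<in> T. a i \<noteq> 0}. a i * \<phi> i x))\<^sup>2"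
    using D unfolding riesz_dictionary_def by blast
  moreover have "(\<Sum>i\<in>{i \<in> T. a i \<noteq> 0}. \<bar>a i\<bar>\<^sup>2) = (\<Sum>i\<in>I. \<bar>b i\<bar>\<^sup>2)"
    unfolding supp using I(1) by (intro sum.mono_neutral_cong_left) (auto simp: a_def)
  moreover have "(\<Sum>i\<in>{i \<in> T. a i \<noteq> 0}. a i * \<phi> i x) = s x" for x
    unfolding supp s_def using I(1) by (intro sum.mono_neutral_cong_left) (auto simp: a_def)
  ultimately have "c * (\<Sum>i\<in>I. \<bar>b i\<bar>\<^sup>2) \<le> 9 / 4"
    using s2 by simp
  then have b2: "(\<Sum>i\<in>I. \<bar>b i\<bar>\<^sup>2) \<le> 9 / (4 * c)"
    using c by (simp add: field_simps)
  have "(\<Sum>i\<in>I. \<bar>b i\<bar>)\<^sup>2 \<le> (\<Sum>i\<in>I. \<bar>b i\<bar>\<^sup>2) * real (card I)"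
    by (rule sum_squared_le_sum_of_squares)
  also have "\<dots> \<le> 9 / (4 * c) * real M"
    using b2 I(3) c by (intro mult_mono) auto
  also have "\<dots> = (3 / 2 * sqrt (real M) / sqrt c)\<^sup>2"
    using c by (simp add: power_mult_distrib power_divide power2_eq_square)
  finally have b1: "(\<Sum>i\<in>I. \<bar>b i\<bar>) \<le> 3 / 2 * sqrt (real M) / sqrt c"
    by (rule power2_le_imp_le) (use c in simp)
  have "L2_inner g s = (\<Sum>i\<in>I. b i * L2_inner g (\<phi> i))"
    unfolding s_def using \<phi> g(1) by (subst L2_inner_sum_right) (auto simp: L2_inner_cmult_right)
  also have "\<dots> \<le> (\<Sum>i\<in>I. \<bar>b i\<bar> * t)"
  proof (rule sum_mono)
    fix i assume "i \<in> I"
    have "b i * L2_inner g (\<phi> i) \<le> \<bar>b i\<bar> * \<bar>L2_inner g (\<phi> i)\<bar>"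
      by (metis abs_ge_self abs_mult)
    also have "\<dots> \<le> \<bar>b i\<bar> * t"
      using small[OF \<open>i \<in> I\<close>] by (rule mult_left_mono) simp
    finally show "b i * L2_inner g (\<phi> i) \<le> \<bar>b i\<bar> * t" .
  qed
  also have "\<dots> = (\<Sum>i\<in>I. \<bar>b i\<bar>) * t"
    by (simp add: sum_distrib_right)
  also have "\<dots> \<le> 3 / 2 * sqrt (real M) / sqrt c * t"
    using b1 by (rule mult_right_mono) (use c in \<open>simp add: t_def\<close>)
  also have "\<dots> = 3 / 10"
    using c M by (simp add: t_def)
  finally have "L2_inner g s \<le> 3 / 10" .
  moreover have "(L2_norm (\<lambda>x. g x - s x))\<^sup>2 \<le> 1/4"
    using power_mono[OF approx L2_norm_nonneg, of 2] by (simp add: s_def power_divide)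
  moreover have "(L2_norm (\<lambda>x. g x - s x))\<^sup>2 = 1 - 2 * L2_inner g s + (L2_norm s)\<^sup>2"
    using L2_norm_diff_power2[OF g(1) s] g(2) by simp
  ultimately show False
    using zero_le_power2[of "L2_norm s"] by linarith
qed

text \<open>Each vector of the almost orthonormal family correlates with one of \<open>N\<close> atoms, and each atom
  correlates with few vectors; the family is therefore small.\<close>

lemma card_le_of_riesz_approximation:
  fixes m k M N :: nat and c :: real
  defines "\<kappa> \<equiv> sqrt c / 5"
  assumes D: "riesz_dictionary c T \<phi>" and c: "0 < c" and M: "1 \<le> M" and m: "1 \<le> m"
    and H: "admissible_subset m k \<alpha> \<beta> H"
    and coh: "4 * real m powr (real k * (\<beta> - \<alpha>)) * real M \<le> \<kappa>\<^sup>2"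
    and approx: "\<And>h. h \<in> H \<Longrightarrow> \<exists>I b. I \<subseteq> {1..N} \<inter> T \<and> card I \<le> M \<and>
      L2_norm (\<lambda>x. L2_normalize h x - (\<Sum>i\<in>I. b i * \<phi> i x)) \<le> 1/2"
  shows "real (card H) \<le> real N * (2 * real M / \<kappa>\<^sup>2)"
proof -
  define \<tau> where "\<tau> = \<kappa> / sqrt (real M)"
  have \<kappa>: "0 < \<kappa>" using c by (simp add: \<kappa>_def)
  have \<tau>: "0 < \<tau>" "\<tau>\<^sup>2 = \<kappa>\<^sup>2 / real M"
    using \<kappa> M by (auto simp: \<tau>_def power_divide)
  have HL: "h \<in> L2" "L2_norm h \<noteq> 0" if "h \<in> H" for h
  proof -
    obtain a where a: "h = hat_comp m a k" "a \<in> index_set m k"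
      using H \<open>h \<in> H\<close> by (auto simp: admissible_subset_def hat_comps_def)
    show "h \<in> L2"
      unfolding a(1) by (rule hat_comp_L2[OF m]) (rule index_set_D[OF a(2)])
    show "L2_norm h \<noteq> 0"
      using H \<open>h \<in> H\<close> by (auto simp: admissible_subset_def)
  qed
  have normalize: "L2_normalize h = (\<lambda>x. 1 / L2_norm h * h x)" for h
    by (simp add: L2_normalize_def)
  have g: "L2_normalize h \<in> L2" "L2_norm (L2_normalize h) = 1" if "h \<in> H" for h
  proof -
    show "L2_normalize h \<in> L2"
      unfolding normalize by (rule L2_cmult[OF HL(1)[OF that]])
    show "L2_norm (L2_normalize h) = 1"
      using HL(2)[OF that] L2_norm_nonneg[of h] unfolding normalize L2_norm_cmult by auto
  qed
  have fin: "finite H"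
    using H finite_hat_comps by (auto simp: admissible_subset_def intro: finite_subset)
  define A where "A i = {h \<in> H. \<tau> \<le> \<bar>L2_inner (L2_normalize h) (\<phi> i)\<bar>}" for i
  have cover: "H \<subseteq> (\<Union>i\<in>{1..N} \<inter> T. A i)"
  proof
    fix h assume h: "h \<in> H"
    obtain I b where I: "I \<subseteq> {1..N} \<inter> T" "card I \<le> M"
      "L2_norm (\<lambda>x. L2_normalize h x - (\<Sum>i\<in>I. b i * \<phi> i x)) \<le> 1/2"
      using approx[OF h] by blast
    have "finite I" "I \<subseteq> T" using I(1) by (auto intro: finite_subset)
    then obtain i where "i \<in> I" "\<tau> \<le> \<bar>L2_inner (L2_normalize h) (\<phi> i)\<bar>"
      using correlated_atom[OF D c g[OF h] _ _ I(2) M I(3)] by (auto simp: \<tau>_def \<kappa>_def)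
    with h I(1) show "h \<in> (\<Union>i\<in>{1..N} \<inter> T. A i)" by (auto simp: A_def)
  qed
  have A: "real (card (A i)) \<le> 2 / \<tau>\<^sup>2" if "i \<in> T" for i
  proof (rule card_correlated_le[where g = L2_normalize and \<phi> = "\<phi> i" and \<nu> = "2 * real m powr (real k * (\<beta> - \<alpha>))"])
    show "2 * real m powr (real k * (\<beta> - \<alpha>)) \<le> \<tau>\<^sup>2 / 2"
      using coh M by (simp add: \<tau>(2) field_simps)
    show "\<bar>L2_inner (L2_normalize h) (L2_normalize h')\<bar> \<le> 2 * real m powr (real k * (\<beta> - \<alpha>))"
      if "h \<in> A i" "h' \<in> A i" "h \<noteq> h'" for h h'
      using H that by (auto simp: admissible_subset_def A_def)
  qed (use D fin g \<tau>(1) that in \<open>auto simp: A_def riesz_dictionary_def\<close>)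
  have "real (card H) \<le> real (card (\<Union>i\<in>{1..N} \<inter> T. A i))"
    using cover fin by (intro of_nat_mono card_mono) (auto simp: A_def)
  also have "\<dots> \<le> real (\<Sum>i\<in>{1..N} \<inter> T. card (A i))"
    by (intro of_nat_mono card_UN_le) auto
  also have "\<dots> \<le> (\<Sum>i\<in>{1..N} \<inter> T. 2 / \<tau>\<^sup>2)"
    unfolding of_nat_sum using A by (intro sum_mono) auto
  also have "\<dots> \<le> real N * (2 / \<tau>\<^sup>2)"
    using card_mono[of "{1..N}" "{1..N} \<inter> T"] by (simp add: divide_right_mono)
  also have "2 / \<tau>\<^sup>2 = 2 * real M / \<kappa>\<^sup>2"
    by (simp add: \<tau>(2))
  finally show ?thesis .
qed

lemma poly_le_power:
  fixes x :: real
  assumes "1 \<le> x"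
  shows "poly p x \<le> (\<Sum>i\<le>degree p. \<bar>coeff p i\<bar>) * x ^ degree p"
proof -
  have "poly p x = (\<Sum>i\<le>degree p. coeff p i * x ^ i)"
    by (rule poly_altdef)
  also have "\<dots> \<le> (\<Sum>i\<le>degree p. \<bar>coeff p i\<bar> * x ^ degree p)"
  proof (rule sum_mono)
    fix i assume "i \<in> {..degree p}"
    then have "x ^ i \<le> x ^ degree p" using assms by (intro power_increasing) auto
    then show "coeff p i * x ^ i \<le> \<bar>coeff p i\<bar> * x ^ degree p"
      using assms by (intro mult_mono) auto
  qed
  finally show ?thesis by (simp add: sum_distrib_right)
qed

lemma big_O_approx_errorD:
  assumes "(\<lambda>M. approx_error C (S M)) \<in> big_O (\<lambda>M. real M powr (-\<gamma>))"
  obtains b where "0 < b"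
    "\<forall>\<^sub>F M in sequentially. \<forall>f\<in>C. \<exists>h\<in>S M. L2_norm (\<lambda>x. f x - h x) \<le> b * real M powr (-\<gamma>)"
proof -
  let ?e = "\<lambda>M. approx_error C (S M)"
  have "limsup (\<lambda>M. ?e M / ennreal (real M powr (-\<gamma>))) < \<infinity>"
    using assms by (simp add: big_O_def)
  then obtain B where B: "limsup (\<lambda>M. ?e M / ennreal (real M powr (-\<gamma>))) < B" "B < \<infinity>"
    using dense by blast
  then obtain b where b: "B = ennreal b" "b \<ge> 0"
    by (cases B) auto
  have ev: "\<forall>\<^sub>F M in sequentially. ?e M / ennreal (real M powr (-\<gamma>)) < B"
    using B(1) by (rule Limsup_lessD)
  have "\<forall>\<^sub>F M in sequentially. \<forall>f\<in>C. \<exists>h\<in>S M. L2_norm (\<lambda>x. f x - h x) \<le> (b + 1) * real M powr (-\<gamma>)"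
    using ev eventually_gt_at_top[of 0]
  proof eventually_elim
    case (elim M)
    let ?x = "real M powr (-\<gamma>)"
    have pos: "?x > 0" using elim by simp
    have "?e M = ?e M / ennreal ?x * ennreal ?x"
      using pos by (simp add: ennreal_divide_times ennreal_times_divide[symmetric] ennreal_divide_self)
    also have "\<dots> \<le> ennreal b * ennreal ?x"
      using elim b by (intro mult_right_mono) auto
    also have "\<dots> = ennreal (b * ?x)"
      using b by (simp add: ennreal_mult)
    also have "\<dots> < ennreal ((b + 1) * ?x)"
      using b pos by (intro ennreal_lessI) auto
    finally have less: "?e M < ennreal ((b + 1) * ?x)" .
    show ?case
    proof
      fix f assume "f \<in> C"
      then have "(INF h\<in>S M. ennreal (L2_norm (\<lambda>x. f x - h x))) \<le> ?e M"
        unfolding approx_error_def by (rule SUP_upper)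
      also note less
      finally obtain h where h: "h \<in> S M" "ennreal (L2_norm (\<lambda>x. f x - h x)) < ennreal ((b + 1) * ?x)"
        by (auto simp: INF_less_iff)
      then show "\<exists>h\<in>S M. L2_norm (\<lambda>x. f x - h x) \<le> (b + 1) * ?x"
        by (intro bexI[of _ h]) (auto simp: ennreal_less_iff L2_norm_nonneg)
    qed
  qed
  with b(2) show thesis by (intro that[of "b + 1"]) auto
qed

text \<open>A rate above \<open>\<mu> / \<delta>\<close> would allow level \<open>m\<close> to be approximated with relative error \<open>1/2\<close>
  by about \<open>m\<^sup>\<delta>\<close> terms. Then the number of its members would be polynomial in \<open>m\<close>, whereas it
  grows superpolynomially.\<close>

lemma riesz_rate_V_class_le:
  fixes k :: nat and \<alpha> \<beta> \<mu> :: real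
  defines "\<delta> \<equiv> real k * (\<alpha> - \<beta>)"
  assumes H: "admissible_choice k \<alpha> \<beta> m\<^sub>0 H" and k: "1 \<le> k"
    and \<alpha>: "\<alpha> < 1/2" and \<beta>: "0 < \<beta>" "\<beta> < \<alpha>"
  shows "riesz_rate (V_class m\<^sub>0 H \<mu>) \<le> ereal (\<mu> / \<delta>)"
  unfolding riesz_rate_def approx_rate_def
proof (rule Sup_least, clarify, rule SUP_least, clarify)
  fix c T \<phi> \<pi> and \<gamma> :: real
  assume c: "0 < c" and D: "riesz_dictionary c T \<phi>" and \<pi>: "\<pi> \<in> nonneg_polys" and \<gamma>: "0 < \<gamma>"
    and O: "(\<lambda>M. approx_error (V_class m\<^sub>0 H \<mu>) (riesz_approximants T \<phi> \<pi> M)) \<in> big_O (\<lambda>M. real M powr (-\<gamma>))"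
  have \<delta>: "0 < \<delta>" using k \<beta> by (simp add: \<delta>_def)
  have "\<gamma> \<le> \<mu> / \<delta>"
  proof (rule ccontr)
    assume "\<not> \<gamma> \<le> \<mu> / \<delta>"
    then have gap: "\<mu> - \<delta> * \<gamma> < 0" using \<delta> by (simp add: field_simps)
    obtain b where b: "0 < b" "\<forall>\<^sub>F M in sequentially. \<forall>f\<in>V_class m\<^sub>0 H \<mu>. \<exists>s\<in>riesz_approximants T \<phi> \<pi> M.
        L2_norm (\<lambda>x. f x - s x) \<le> b * real M powr (-\<gamma>)"
      using big_O_approx_errorD[OF O] by blast
    define \<kappa> where "\<kappa> = sqrt c / 5"
    define \<epsilon> where "\<epsilon> = \<kappa>\<^sup>2 / 4"
    define P where "P = (\<Sum>i\<le>degree \<pi>. \<bar>coeff \<pi> i\<bar>)"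
    define q where "q = \<delta> * real (degree \<pi> + 1)"
    define C where "C = P * 2 / \<kappa>\<^sup>2 * \<epsilon> ^ (degree \<pi> + 1)"
    \<comment> \<open>the largest number of terms that the coherence of level \<open>m\<close> allows\<close>
    define M where "M m = nat \<lfloor>\<epsilon> * real m powr \<delta>\<rfloor>" for m
    have \<kappa>: "0 < \<kappa>" using c by (simp add: \<kappa>_def)
    then have \<epsilon>: "0 < \<epsilon>" by (simp add: \<epsilon>_def)
    have P: "0 \<le> P" by (simp add: P_def sum_nonneg)
    have lim: "filterlim (\<lambda>m. \<epsilon> * real m powr \<delta>) at_top sequentially"
      using \<epsilon> \<delta> by real_asymp
    have limM: "filterlim M at_top sequentially"
      unfolding M_def
      by (intro filterlim_compose[OF filterlim_nat_sequentially] filterlim_compose[OF filterlim_floor_sequentially] lim)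
    have "(\<lambda>m. b * (\<epsilon> / 2) powr (-\<gamma>) * real m powr (\<mu> - \<delta> * \<gamma>)) \<longlonglongrightarrow> b * (\<epsilon> / 2) powr (-\<gamma>) * 0"
      using gap by (intro tendsto_mult_left tendsto_neg_powr filterlim_real_sequentially)
    then have ev2: "\<forall>\<^sub>F m in sequentially. b * (\<epsilon> / 2) powr (-\<gamma>) * real m powr (\<mu> - \<delta> * \<gamma>) < 1/2"
      by (rule order_tendstoD) simp
    have "filterlim (\<lambda>m. (1/2 - \<alpha>) * real m powr \<beta>) at_top sequentially"
    proof -
      have "0 < 1/2 - \<alpha>" using \<alpha> by simp
      then show ?thesis using \<beta>(1) by real_asymp
    qed
    then have ev3: "\<forall>\<^sub>F m in sequentially. q + 1 \<le> (1/2 - \<alpha>) * real m powr \<beta>"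
      by (simp add: filterlim_at_top)
    have ev4: "\<forall>\<^sub>F m in sequentially. 2 * real k * C < real m"
      using filterlim_real_sequentially by (simp add: filterlim_at_top_dense)
    have ev5: "\<forall>\<^sub>F m in sequentially. 2 \<le> \<epsilon> * real m powr \<delta>"
      using lim by (simp add: filterlim_at_top)
    have "\<forall>\<^sub>F m in sequentially. False"
      using filterlim_iff[THEN iffD1, OF limM, rule_format, OF b(2)] ev2 ev3 ev4 ev5
        eventually_ge_at_top[of "max 1 m\<^sub>0"]
    proof eventually_elim
      case (elim m)
      let ?M = "M m"
      have m: "1 \<le> m" "m\<^sub>0 \<le> m" using elim(6) by auto
      have adm: "admissible_subset m k \<alpha> \<beta> (H m)"
        using H m(2) by (simp add: admissible_choice_def)
      have M: "real ?M \<le> \<epsilon> * real m powr \<delta>" "\<epsilon> / 2 * real m powr \<delta> \<le> real ?M" "1 \<le> ?M"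
        using elim(5) unfolding M_def by linarith+
      have coh: "4 * real m powr (real k * (\<beta> - \<alpha>)) * real ?M \<le> \<kappa>\<^sup>2"
      proof -
        have "4 * real m powr (real k * (\<beta> - \<alpha>)) * real ?M \<le> 4 * real m powr (- \<delta>) * (\<epsilon> * real m powr \<delta>)"
          using M(1) by (intro mult_mono) (auto simp: \<delta>_def algebra_simps)
        also have "\<dots> = \<kappa>\<^sup>2"
          using m by (simp add: \<epsilon>_def powr_minus field_simps)
        finally show ?thesis .
      qed
      have err: "b * real ?M powr (-\<gamma>) \<le> 1/2 * real m powr (-\<mu>)"
      proof -
        have "real ?M powr (-\<gamma>) \<le> (\<epsilon> / 2 * real m powr \<delta>) powr (-\<gamma>)"
          using M(2) \<epsilon> m \<gamma> by (intro powr_mono2') auto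
        also have "\<dots> = (\<epsilon> / 2) powr (-\<gamma>) * real m powr (\<mu> - \<delta> * \<gamma>) * real m powr (-\<mu>)"
          using m \<epsilon> by (subst powr_mult) (auto simp: powr_powr powr_add[symmetric])
        finally have "b * real ?M powr (-\<gamma>)
            \<le> b * (\<epsilon> / 2) powr (-\<gamma>) * real m powr (\<mu> - \<delta> * \<gamma>) * real m powr (-\<mu>)"
          using b(1) by (simp add: mult.assoc)
        also have "\<dots> \<le> 1/2 * real m powr (-\<mu>)"
          using elim(2) by (intro mult_right_mono) auto
        finally show ?thesis .
      qed
      have "real (card (H m)) \<le> real (nat \<lfloor>poly \<pi> (real ?M)\<rfloor>) * (2 * real ?M / \<kappa>\<^sup>2)"
        unfolding \<kappa>_def
      proof (rule card_le_of_riesz_approximation[OF D c M(3) m(1) adm coh[unfolded \<kappa>_def]])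
        fix h assume h: "h \<in> H m"
        let ?f = "\<lambda>x. real m powr (-\<mu>) * L2_normalize h x"
        have "?f \<in> V_class m\<^sub>0 H \<mu>"
          using h m(2) by (auto simp: V_class_def V_level_def intro!: exI[of _ m])
        from bspec[OF elim(1) this] obtain s where s: "s \<in> riesz_approximants T \<phi> \<pi> ?M"
          "L2_norm (\<lambda>x. ?f x - s x) \<le> b * real ?M powr (-\<gamma>)"
          by (rule bexE)
        then obtain I a where I: "I \<subseteq> {1..nat \<lfloor>poly \<pi> (real ?M)\<rfloor>} \<inter> T" "card I \<le> ?M"
          and s_eq: "s = (\<lambda>x. \<Sum>i\<in>I. a i * \<phi> i x)"
          unfolding riesz_approximants_def by blast
        have scale: "real m powr \<mu> * real m powr (-\<mu>) = 1"
          using m by (simp add: powr_minus field_simps)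
        have "(\<lambda>x. L2_normalize h x - (\<Sum>i\<in>I. real m powr \<mu> * a i * \<phi> i x)) = (\<lambda>x. real m powr \<mu> * (?f x - s x))"
          using scale by (auto simp: s_eq right_diff_distrib sum_distrib_left mult.assoc[symmetric])
        then have "L2_norm (\<lambda>x. L2_normalize h x - (\<Sum>i\<in>I. real m powr \<mu> * a i * \<phi> i x))
            = real m powr \<mu> * L2_norm (\<lambda>x. ?f x - s x)"
          by (simp only: L2_norm_cmult) simp
        also have "\<dots> \<le> real m powr \<mu> * (1/2 * real m powr (-\<mu>))"
          using s(2) err by (intro mult_left_mono) auto
        also have "\<dots> = 1/2" using scale by simp
        finally have "L2_norm (\<lambda>x. L2_normalize h x - (\<Sum>i\<in>I. real m powr \<mu> * a i * \<phi> i x)) \<le> 1/2" .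
        with I show "\<exists>I b. I \<subseteq> {1..nat \<lfloor>poly \<pi> (real ?M)\<rfloor>} \<inter> T \<and> card I \<le> ?M \<and>
            L2_norm (\<lambda>x. L2_normalize h x - (\<Sum>i\<in>I. b i * \<phi> i x)) \<le> 1/2"
          by (intro exI[of _ I] exI[of _ "\<lambda>i. real m powr \<mu> * a i"]) simp
      qed
      also have "\<dots> \<le> P * real ?M ^ degree \<pi> * (2 * real ?M / \<kappa>\<^sup>2)"
      proof (rule mult_right_mono)
        have "0 \<le> poly \<pi> (real ?M)"
          unfolding poly_altdef using \<pi> by (intro sum_nonneg) (auto simp: nonneg_polys_def)
        then have "real (nat \<lfloor>poly \<pi> (real ?M)\<rfloor>) \<le> poly \<pi> (real ?M)" by linarith
        also have "\<dots> \<le> P * real ?M ^ degree \<pi>"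
          unfolding P_def using M(3) by (intro poly_le_power) auto
        finally show "real (nat \<lfloor>poly \<pi> (real ?M)\<rfloor>) \<le> P * real ?M ^ degree \<pi>" .
      qed simp
      also have "\<dots> = P * 2 / \<kappa>\<^sup>2 * real ?M ^ (degree \<pi> + 1)" by simp
      also have "\<dots> \<le> P * 2 / \<kappa>\<^sup>2 * (\<epsilon> * real m powr \<delta>) ^ (degree \<pi> + 1)"
        using M(1) P by (intro mult_left_mono power_mono) auto
      also have "\<dots> = C * real m powr q"
        using m by (simp add: C_def q_def power_mult_distrib powr_realpow[symmetric] powr_powr
            del: power_Suc)
      finally have upper: "real (card (H m)) \<le> C * real m powr q" .
      have "C * real m powr q < 1 / (2 * real k) * real m * real m powr q"
        using elim(4) k m by (intro mult_strict_right_mono) (auto simp: field_simps)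
      also have "\<dots> = 1 / (2 * real k) * real m powr (q + 1)"
        using m by (simp add: powr_add)
      also have "\<dots> \<le> 1 / (2 * real k) * real m powr ((1/2 - \<alpha>) * real m powr \<beta>)"
        using elim(3) m by (intro mult_left_mono powr_mono) auto
      also have "\<dots> \<le> real (card (H m))"
        using adm by (simp add: admissible_subset_def)
      finally show False using upper by simp
    qed
    then show False by simp
  qed
  then show "ereal \<gamma> \<le> ereal (\<mu> / \<delta>)" by simp
qed


section \<open>The gap between the rates\<close>

theorem mainTheorem3:
  fixes \<rho> :: "real \<Rightarrow> real" and \<alpha> \<beta> :: real
    and m\<^sub>0 :: "nat \<Rightarrow> nat" and H :: "nat \<Rightarrow> nat \<Rightarrow> (real \<Rightarrow> real) set"
  assumes "\<rho> = (\<lambda>x. max 0 x)"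
    and "0 < \<alpha>" "\<alpha> < 1/2"
    and "0 < \<beta>" "\<beta> < \<alpha>"
    and "\<And>k. k \<ge> 1 \<Longrightarrow> admissible_choice k \<alpha> \<beta> (m\<^sub>0 k) (H k)"
  shows "((\<lambda>k. nn_rate \<rho> (V_class (m\<^sub>0 k) (H k) (sqrt (real k)))) \<longlonglongrightarrow> \<infinity>) \<and>
         (\<exists>l \<le> ereal (1/2).
            (\<lambda>k. riesz_rate (V_class (m\<^sub>0 k) (H k) (sqrt (real k)))) \<longlonglongrightarrow> l)"
proof
  have nn: "ereal (sqrt (real k)) \<le> nn_rate \<rho> (V_class (m\<^sub>0 k) (H k) (sqrt (real k)))" if "1 \<le> k" for k
    unfolding assms(1) using that by (intro nn_rate_V_class_ge[OF assms(6)[OF that]]) simp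
  have sqrt_lim: "filterlim (\<lambda>k. sqrt (real k)) at_top sequentially"
    by real_asymp
  show "(\<lambda>k. nn_rate \<rho> (V_class (m\<^sub>0 k) (H k) (sqrt (real k)))) \<longlonglongrightarrow> \<infinity>"
    unfolding tendsto_PInfty
  proof
    fix r
    have "\<forall>\<^sub>F k in sequentially. r < sqrt (real k)"
      using sqrt_lim by (simp add: filterlim_at_top_dense)
    then show "\<forall>\<^sub>F k in sequentially. ereal r < nn_rate \<rho> (V_class (m\<^sub>0 k) (H k) (sqrt (real k)))"
      using eventually_ge_at_top[of 1]
    proof eventually_elim
      case (elim k)
      then show ?case
        by (intro less_le_trans[OF _ nn]) auto
    qed
  qed
next
  let ?R = "\<lambda>k. riesz_rate (V_class (m\<^sub>0 k) (H k) (sqrt (real k)))"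
  have "?R \<longlonglongrightarrow> 0"
  proof (rule tendsto_sandwich)
    show "\<forall>\<^sub>F k in sequentially. 0 \<le> ?R k"
      using eventually_ge_at_top[of 1]
      by eventually_elim (rule riesz_rate_V_class_ge_0[OF assms(6)]; simp)
    show "\<forall>\<^sub>F k in sequentially. ?R k \<le> ereal (sqrt (real k) / (real k * (\<alpha> - \<beta>)))"
      using eventually_ge_at_top[of 1]
      by eventually_elim (rule riesz_rate_V_class_le[OF assms(6) _ assms(3,4,5)]; simp)
    have "0 < \<alpha> - \<beta>" using assms(5) by simp
    then have "(\<lambda>k. sqrt (real k) / (real k * (\<alpha> - \<beta>))) \<longlonglongrightarrow> 0"
      by real_asymp
    then show "(\<lambda>k. ereal (sqrt (real k) / (real k * (\<alpha> - \<beta>)))) \<longlonglongrightarrow> 0"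
      by (simp add: zero_ereal_def)
  qed simp
  then show "\<exists>l \<le> ereal (1/2). ?R \<longlonglongrightarrow> l"
    by (intro exI[of _ 0]) auto
qed

end
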